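(* Let $p\ge2$ be an integer, $r_0,r_2,\varepsilon_0,\delta>0$ with $\delta$ sufficiently small, $D_1=D(0,r_0)$, $D_2=D(0,r_2)$, $\Sigma=S(-\delta,\delta,\varepsilon_0)$. Let $P(x,y,\varepsilon)$ be analytic and bounded on $D_1\times D_2\times\Sigma$ and Gevrey of order $1$ in $\varepsilon\in\Sigma$. Let $V=V(\alpha,\beta,\infty,\mu)$ with $\mu\in\mathbb R$ (positive or negative) and $-\frac{3\pi}{2p}<\alpha<0<\beta<\frac{3\pi}{2p}$. Then the equation $$\varepsilon y'=px^{p-1}y+\varepsilon P(x,y,\varepsilon),\qquad \varepsilon=\eta^p,$$ has a unique formal combined solution $\hat y$ in $\eta\,\tilde{\mathcal C}(V)$.
   Context: $D(0,r)$ is the open disc; $S(\alpha,\beta,r)=\{x\in\mathbb C:0<|x|<r,\ \alpha<\arg x<\beta\}$. For $\mu>0$, $V(\alpha,\beta,r,\mu)=\{x:(|x|<r\text{ and }\alpha<\arg x<\beta)\text{ or }|x|<\mu\}$; for $\mu<0$, $V(\alpha,\beta,r,\mu)=\{x:-\mu<|x|<r,\alpha<\arg x<\beta\}$. $\mathcal G(V)$ is the space of bounded holomorphic functions $g$ on $V$ with a Poincaré asymptotic expansion without constant term $g(X)\sim\sum_{m\ge1}g_mX^{-m}$ as $V\ni X\to\infty$. $P$ Gevrey of order 1 means that there are analytic functions $P_k(x,y)$ and constants $C,A$ with $|P(x,y,\varepsilon)-\sum_{k<N}P_k(x,y)\varepsilon^k|\le CA^NN!|\varepsilon|^N$ for all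 $N$, uniformly on $D_1\times D_2\times\Sigma$. $\tilde{\mathcal C}(V)$ is the set of formal combined series $\sum_{n\ge0}(a_n(x)+g_n(\frac x\eta))\eta^n$, i.e. sequences of pairs $(a_n,g_n)$, with $a_n$ holomorphic (not necessarily bounded) on $D_1$ and $g_n\in\mathcal G(V)$, with the $\eta$-adic topology. $\eta\,\tilde{\mathcal C}(V)$ is the subset of series with $a_0\equiv0$, $g_0\equiv0$. It is an algebra: products $a\cdot b$ and $g\cdot h$ are the usual ones, and the product of a holomorphic function $a(x)=\sum_\nu a_\nu x^\nu$ and of $g\in\mathcal G(V)$, $g(X)\sim\sum_{\nu\ge1}g_\nu X^{-\nu}$, $g_0:=0$, is $\sum_{\nu\ge0}\left(g_\nu(\mathbf S^\nu a)(x)+a_\nu(\mathbf T^\nu g)(\tfrac x\eta)\right)\eta^\nu$, where $(\mathbf Sa)(x)=\frac{a(x)-a(0)}x$ and $(\mathbf Tg)(X)=Xg(X)-g_1$; this is extended bilinearly and continuously. The operator $\eta\frac{d}{dx}$ maps $\sum(a_n(x)+g_n(\frac x\eta))\eta^n$ to $\sum(a_n'(x)\eta+g_n'(\frac x\eta))\eta^n$ (the derivatives $g_n'$ are considered as elements of $\mathcal G(\tilde V)$ for slightly smaller quasi-sectors $\tilde V$), and $\varepsilon\frac d{dx}=\eta^{p-1}\cdot\eta\frac d{dx}$. For $\hat y\in\eta\,\tilde{\mathcal C}(V)$, $P(x,\hat y,\eta^p)$ is defined by substitution into the formal series $\sum_{j,k\ge0}P_{jk}(x)y^j\eta^{pk}$,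 where $P_k(x,y)=\sum_jP_{jk}(x)y^j$. A formal combined solution is a $\hat y$ satisfying the resulting identity between formal combined series. *)

theory Defs
  imports "HOL-Complex_Analysis.Complex_Analysis" "HOL-Library.Landau_Symbols"
    "HOL-Library.Extended_Real"
begin

section \<open>Sectors and quasi-sectors\<close>

text \<open>Angles are measured by the principal argument \<^const>\<open>Arg\<close>, with values in the interval
  from \<open>-\<pi>\<close> (excluded) to \<open>\<pi>\<close>. So both definitions have their usual meaning for
  \<open>-\<pi> \<le> \<alpha> < \<beta> \<le> \<pi>\<close>. The radius of a quasi-sector may be infinite.\<close>

definition sector :: "real \<Rightarrow> real \<Rightarrow> real \<Rightarrow> complex set" where
  "sector \<alpha> \<beta> r = {x. 0 < norm x \<and> norm x < r \<and> \<alpha> < Arg x \<and> Arg x < \<beta>}"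

definition quasi_sector :: "real \<Rightarrow> real \<Rightarrow> ereal \<Rightarrow> real \<Rightarrow> complex set" where
  "quasi_sector \<alpha> \<beta> r \<mu> =
     (if 0 < \<mu>
      then {x. (ereal (norm x) < r \<and> \<alpha> < Arg x \<and> Arg x < \<beta>) \<or> norm x < \<mu>}
      else {x. - \<mu> < norm x \<and> ereal (norm x) < r \<and> \<alpha> < Arg x \<and> Arg x < \<beta>})"


section \<open>Analytic functions of several variables, Gevrey expansions\<close>

definition analytic2_on :: "(complex \<Rightarrow> complex \<Rightarrow> complex) \<Rightarrow> (complex \<times> complex) set \<Rightarrow> bool" where
  "analytic2_on f U \<longleftrightarrow>
     (\<forall>(x0, y0) \<in> U. \<exists>r>0. \<exists>c :: nat \<Rightarrow> nat \<Rightarrow> complex. \<forall>x\<in>ball x0 r. \<forall>y\<in>ball y0 r.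
        ((\<lambda>(i, j). c i j * (x - x0) ^ i * (y - y0) ^ j) has_sum f x y) UNIV)"

definition analytic3_on ::
  "(complex \<Rightarrow> complex \<Rightarrow> complex \<Rightarrow> complex) \<Rightarrow> (complex \<times> complex \<times> complex) set \<Rightarrow> bool" where
  "analytic3_on f U \<longleftrightarrow>
     (\<forall>(x0, y0, z0) \<in> U. \<exists>r>0. \<exists>c :: nat \<Rightarrow> nat \<Rightarrow> nat \<Rightarrow> complex.
        \<forall>x\<in>ball x0 r. \<forall>y\<in>ball y0 r. \<forall>z\<in>ball z0 r.
        ((\<lambda>(i, j, k). c i j k * (x - x0) ^ i * (y - y0) ^ j * (z - z0) ^ k) has_sum f x y z) UNIV)"

text \<open>\<open>P\<close> is Gevrey of order 1 on \<open>D1 \<times> D2 \<times> E\<close> with expansion \<open>\<Sum>\<^sub>k P\<^sub>k(x,y) \<epsilon>\<^sup>k\<close>. If \<open>0\<close> is a limit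
  point of \<open>E\<close>, then \<open>P\<close> determines the functions \<open>P\<^sub>k\<close> on \<open>D1 \<times> D2\<close>.\<close>

definition gevrey1_expansion ::
  "complex set \<Rightarrow> complex set \<Rightarrow> complex set \<Rightarrow> (complex \<Rightarrow> complex \<Rightarrow> complex \<Rightarrow> complex)
   \<Rightarrow> (nat \<Rightarrow> complex \<Rightarrow> complex \<Rightarrow> complex) \<Rightarrow> bool" where
  "gevrey1_expansion D1 D2 E P Pk \<longleftrightarrow>
     (\<forall>k. analytic2_on (Pk k) (D1 \<times> D2)) \<and>
     (\<exists>C>0. \<exists>A>0. \<forall>N. \<forall>x\<in>D1. \<forall>y\<in>D2. \<forall>\<epsilon>\<in>E.
        norm (P x y \<epsilon> - (\<Sum>k<N. Pk k x y * \<epsilon> ^ k)) \<le> C * A ^ N * fact N * norm \<epsilon> ^ N)"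


section \<open>The space \<open>\<G>(V)\<close>\<close>

definition poincare_expansion ::
  "complex set \<Rightarrow> (complex \<Rightarrow> complex) \<Rightarrow> (nat \<Rightarrow> complex) \<Rightarrow> bool" where
  "poincare_expansion V g c \<longleftrightarrow>
     (\<forall>N. (\<lambda>X. g X - (\<Sum>m=1..N. c m / X ^ m)) \<in> O[inf at_infinity (principal V)](\<lambda>X. 1 / X ^ Suc N))"

definition G_space :: "complex set \<Rightarrow> (complex \<Rightarrow> complex) set" where
  "G_space V = {g. g holomorphic_on V \<and> bounded (g ` V) \<and> (\<exists>c. poincare_expansion V g c)}"

text \<open>The coefficients \<open>g\<^sub>m\<close> of the expansion, with the convention \<open>g\<^sub>0 = 0\<close>. They are uniquely
  determined if \<open>V\<close> is unbounded.\<close>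

definition asymp_coeff :: "complex set \<Rightarrow> (complex \<Rightarrow> complex) \<Rightarrow> nat \<Rightarrow> complex" where
  "asymp_coeff V g = (THE c. c 0 = 0 \<and> poincare_expansion V g c)"

definition taylor_coeff :: "(complex \<Rightarrow> complex) \<Rightarrow> nat \<Rightarrow> complex" where
  "taylor_coeff a n = (deriv ^^ n) a 0 / fact n"

text \<open>The operators \<open>\<^bold>S\<close> and \<open>\<^bold>T\<close>; at \<open>0\<close> the quotient is continued by its limit.\<close>

definition S_op :: "(complex \<Rightarrow> complex) \<Rightarrow> complex \<Rightarrow> complex" where
  "S_op a x = (if x = 0 then deriv a 0 else (a x - a 0) / x)"

definition T_op :: "complex set \<Rightarrow> (complex \<Rightarrow> complex) \<Rightarrow> complex \<Rightarrow> complex" where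
  "T_op V g X = X * g X - asymp_coeff V g 1"


section \<open>Formal combined series\<close>

text \<open>The sequence of the pairs \<open>(a\<^sub>n, g\<^sub>n)\<close> stands for \<open>\<Sum>\<^sub>n (a\<^sub>n(x) + g\<^sub>n(x/\<eta>)) \<eta>\<^sup>n\<close>. Since
  functions are total in HOL, two series are equal if their coefficients coincide on \<open>D\<close> and on
  \<open>V\<close>, respectively.\<close>

type_synonym coeff_pair = "(complex \<Rightarrow> complex) \<times> (complex \<Rightarrow> complex)"
type_synonym combined = "nat \<Rightarrow> coeff_pair"

definition pair_eq :: "complex set \<Rightarrow> complex set \<Rightarrow> coeff_pair \<Rightarrow> coeff_pair \<Rightarrow> bool" where
  "pair_eq D V u v \<longleftrightarrow> (\<forall>x\<in>D. fst u x = fst v x) \<and> (\<forall>X\<in>V. snd u X = snd v X)"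

definition combined_eq :: "complex set \<Rightarrow> complex set \<Rightarrow> combined \<Rightarrow> combined \<Rightarrow> bool" where
  "combined_eq D V u v \<longleftrightarrow> (\<forall>n. pair_eq D V (u n) (v n))"

definition combined_space :: "complex set \<Rightarrow> complex set \<Rightarrow> combined set" where
  "combined_space D V = {u. \<forall>n. fst (u n) holomorphic_on D \<and> snd (u n) \<in> G_space V}"

definition eta_combined_space :: "complex set \<Rightarrow> complex set \<Rightarrow> combined set" where
  "eta_combined_space D V =
     {u \<in> combined_space D V. pair_eq D V (u 0) (\<lambda>x. 0, \<lambda>X. 0)}"

definition combined_sum :: "('i \<Rightarrow> combined) \<Rightarrow> 'i set \<Rightarrow> combined" where
  "combined_sum f F n = (\<lambda>x. \<Sum>i\<in>F. fst (f i n) x, \<lambda>X. \<Sum>i\<in>F. snd (f i n) X)"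

definition combined_add :: "combined \<Rightarrow> combined \<Rightarrow> combined" where
  "combined_add u v n = (\<lambda>x. fst (u n) x + fst (v n) x, \<lambda>X. snd (u n) X + snd (v n) X)"

definition of_holo :: "(complex \<Rightarrow> complex) \<Rightarrow> combined" where
  "of_holo a n = (if n = 0 then (a, \<lambda>X. 0) else (\<lambda>x. 0, \<lambda>X. 0))"

text \<open>Multiplication by \<open>\<eta>\<^sup>k\<close>.\<close>

definition eta_shift :: "nat \<Rightarrow> combined \<Rightarrow> combined" where
  "eta_shift k u n = (if n < k then (\<lambda>x. 0, \<lambda>X. 0) else u (n - k))"

text \<open>\<open>pair_mult V (a, g) (b, h)\<close> is the product \<open>(a(x) + g(x/\<eta>)) (b(x) + h(x/\<eta>))\<close>: the terms \<open>a b\<close>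
  and \<open>g h\<close> have order \<open>0\<close> in \<open>\<eta>\<close>, and \<open>a h\<close> as well as \<open>b g\<close> are re-expanded using
  \<open>a \<cdot> h = \<Sum>\<^sub>\<nu> (h\<^sub>\<nu> (S\<^sup>\<nu> a)(x) + a\<^sub>\<nu> (T\<^sup>\<nu> h)(x/\<eta>)) \<eta>\<^sup>\<nu>\<close>.\<close>

definition pair_mult :: "complex set \<Rightarrow> coeff_pair \<Rightarrow> coeff_pair \<Rightarrow> combined" where
  "pair_mult V u v \<nu> =
     (case (u, v) of ((a, g), (b, h)) \<Rightarrow>
       (\<lambda>x. (if \<nu> = 0 then a x * b x else 0)
              + asymp_coeff V h \<nu> * (S_op ^^ \<nu>) a x + asymp_coeff V g \<nu> * (S_op ^^ \<nu>) b x,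
        \<lambda>X. (if \<nu> = 0 then g X * h X else 0)
              + taylor_coeff a \<nu> * (T_op V ^^ \<nu>) h X + taylor_coeff b \<nu> * (T_op V ^^ \<nu>) g X))"

definition combined_mult :: "complex set \<Rightarrow> combined \<Rightarrow> combined \<Rightarrow> combined" where
  "combined_mult V u v n =
     (\<lambda>x. \<Sum>i\<le>n. \<Sum>j\<le>n - i. fst (pair_mult V (u i) (v j) (n - i - j)) x,
      \<lambda>X. \<Sum>i\<le>n. \<Sum>j\<le>n - i. snd (pair_mult V (u i) (v j) (n - i - j)) X)"

primrec combined_power :: "complex set \<Rightarrow> combined \<Rightarrow> nat \<Rightarrow> combined" where
  "combined_power V u 0 = of_holo (\<lambda>x. 1)"
| "combined_power V u (Suc j) = combined_mult V u (combined_power V u j)"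

text \<open>The operator \<open>\<eta> d/dx\<close>. For \<open>g\<close> in \<open>\<G>(V)\<close>, the derivative \<open>g'\<close> need only belong to
  \<open>\<G>(W)\<close> for smaller quasi-sectors \<open>W\<close>; as these exhaust \<open>V\<close>, it is compared with other functions
  on all of \<open>V\<close>.\<close>

definition eta_deriv :: "combined \<Rightarrow> combined" where
  "eta_deriv u n = (if n = 0 then (\<lambda>x. 0) else deriv (fst (u (n - 1))), deriv (snd (u n)))"

text \<open>Unconditional summation in the \<open>\<eta>\<close>-adic topology, i.e. each coefficient of the finite partial
  sums is eventually constant.\<close>

definition eta_adic_sum ::
  "complex set \<Rightarrow> complex set \<Rightarrow> ('i \<Rightarrow> combined) \<Rightarrow> 'i set \<Rightarrow> combined \<Rightarrow> bool" where
  "eta_adic_sum D V f I s \<longleftrightarrow>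
     (\<forall>n. \<forall>\<^sub>F F in finite_subsets_at_top I. pair_eq D V (combined_sum f F n) (s n))"


section \<open>The differential equation\<close>

text \<open>The function \<open>P\<^sub>j\<^sub>k\<close> in the expansion \<open>P\<^sub>k(x,y) = \<Sum>\<^sub>j P\<^sub>j\<^sub>k(x) y\<^sup>j\<close>.\<close>

definition y_coeff :: "(nat \<Rightarrow> complex \<Rightarrow> complex \<Rightarrow> complex) \<Rightarrow> nat \<Rightarrow> nat \<Rightarrow> complex \<Rightarrow> complex" where
  "y_coeff Pk j k x = taylor_coeff (Pk k x) j"

text \<open>\<open>w\<close> is the series \<open>P(x, y, \<eta>\<^sup>p) = \<Sum>\<^sub>j\<^sub>k P\<^sub>j\<^sub>k(x) y\<^sup>j \<eta>\<^sup>p\<^sup>k\<close>.\<close>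

definition is_substitution ::
  "complex set \<Rightarrow> complex set \<Rightarrow> nat \<Rightarrow> (nat \<Rightarrow> complex \<Rightarrow> complex \<Rightarrow> complex)
   \<Rightarrow> combined \<Rightarrow> combined \<Rightarrow> bool" where
  "is_substitution D V p Pk y w \<longleftrightarrow>
     w \<in> combined_space D V \<and>
     eta_adic_sum D V
       (\<lambda>(j, k). eta_shift (p * k)
          (combined_mult V (of_holo (y_coeff Pk j k)) (combined_power V y j))) UNIV w"

text \<open>\<open>y\<close> satisfies \<open>\<epsilon> y' = p x\<^sup>p\<^sup>-\<^sup>1 y + \<epsilon> P(x, y, \<epsilon>)\<close>, \<open>\<epsilon> = \<eta>\<^sup>p\<close>, where
  \<open>\<epsilon> d/dx = \<eta>\<^sup>p\<^sup>-\<^sup>1 \<cdot> \<eta> d/dx\<close>.\<close>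

definition formal_combined_solution ::
  "complex set \<Rightarrow> complex set \<Rightarrow> nat \<Rightarrow> (nat \<Rightarrow> complex \<Rightarrow> complex \<Rightarrow> complex)
   \<Rightarrow> combined \<Rightarrow> bool" where
  "formal_combined_solution D V p Pk y \<longleftrightarrow>
     (\<exists>w. is_substitution D V p Pk y w \<and>
       combined_eq D V
         (eta_shift (p - 1) (eta_deriv y))
         (combined_add
            (combined_mult V (of_holo (\<lambda>x. of_nat p * x ^ (p - 1))) y)
            (eta_shift p w)))"

end

theory Submission
  imports Defs
begin

text \<open>
  Write the unknown as \<open>y = \<Sum>\<^sub>n (a\<^sub>n(x) + g\<^sub>n(x/\<eta>)) \<eta>\<^sup>n\<close> and let \<open>w\<close> be the series \<open>P(x, y, \<eta>\<^sup>p)\<close>, with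
  coefficients \<open>(u\<^sub>n, v\<^sub>n)\<close>. Since \<open>y\<close> has no term of order \<open>0\<close>, the \<open>n\<close>-th coefficient of \<open>w\<close> is a finite
  expression in the coefficients of \<open>y\<close> up to \<open>n\<close>. As \<open>x\<^sup>p\<^sup>-\<^sup>1\<close> is a monomial, the re-expansion of
  \<open>p x\<^sup>p\<^sup>-\<^sup>1 y\<close> is explicit, and comparing coefficients (\<open>solution_iff\<close>) turns the equation into

  \<^item> \<open>a\<^sub>n\<^sub>-\<^sub>p' - u\<^sub>n\<^sub>-\<^sub>p = p x\<^sup>p\<^sup>-\<^sup>1 a\<^sub>n + p \<Sum>\<^sub>\<nu> g\<^sub>n\<^sub>-\<^sub>\<nu>\<^sub>,\<^sub>\<nu> x\<^sup>p\<^sup>-\<^sup>1\<^sup>-\<^sup>\<nu>\<close>, summed over \<open>1 \<le> \<nu> < p\<close>,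
  \<^item> \<open>g\<^sub>n' = p T\<^sup>p\<^sup>-\<^sup>1 g\<^sub>n + v\<^sub>n\<^sub>-\<^sub>1\<close>,

  where \<open>g\<^sub>m\<^sub>,\<^sub>\<nu>\<close> is the coefficient of \<open>X\<^sup>-\<^sup>\<nu>\<close> in the expansion of \<open>g\<^sub>m\<close>. In the first equation the part
  of degree at most \<open>p - 2\<close> must come from the sum, so it fixes \<open>g\<^sub>m\<^sub>,\<^sub>\<nu>\<close> for \<open>1 \<le> \<nu> < p\<close> from the
  coefficients of \<open>y\<close> below \<open>m\<close>; the rest is divisible by \<open>x\<^sup>p\<^sup>-\<^sup>1\<close> and gives \<open>a\<^sub>n\<close>. With the leading
  coefficients \<open>c\<^sub>\<nu> = g\<^sub>n\<^sub>,\<^sub>\<nu>\<close> known, the second equation is the linear differential equation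
  \<open>g' = p X\<^sup>p\<^sup>-\<^sup>1 g - p \<Sum>\<^sub>\<nu> c\<^sub>\<nu> X\<^sup>p\<^sup>-\<^sup>1\<^sup>-\<^sup>\<nu> + v\<^sub>n\<^sub>-\<^sub>1\<close>. So the coefficients are determined one after the
  other, provided that this equation has exactly one solution in \<open>\<G>(V)\<close>, and that this solution has the
  prescribed leading coefficients.

  Uniqueness (\<open>linear_equation_unique\<close>): the difference of two solutions is a multiple of
  \<open>exp(X\<^sup>p)\<close>, which is unbounded on the positive real axis. Existence (\<open>linear_equation_exists\<close>): take
  \<open>g = exp(X\<^sup>p) F\<close>, where \<open>F\<close> is the primitive of \<open>exp(-X\<^sup>p) f(X)\<close> on the simply connected set \<open>V\<close> that
  vanishes at infinity along the positive axis. If \<open>f\<close> decays like a high power of \<open>1/X\<close>, then so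
  does \<open>g\<close>, with a loss of the fixed power \<open>X\<^sup>p\<close> (\<open>decay_bound\<close>). This is seen on three kinds of
  paths, along which \<open>exp(X\<^sup>p - t\<^sup>p)\<close> remains under control: the positive axis; arcs from there to
  arguments of modulus at most \<open>\<pi>/p\<close>; and, for the remaining arguments of modulus less than \<open>3\<pi>/(2p)\<close>,
  where \<open>exp(X\<^sup>p)\<close> decays, rays going outwards from a fixed circle. The loss does no harm: a partial sum
  of the formal solution may be subtracted first, as long a one as desired.
\<close>

section \<open>Functions with a Poincare expansion\<close>

lemma eventually_inf_at_infinity:
  fixes V :: "complex set"
  shows "eventually Q (inf at_infinity (principal V)) \<longleftrightarrow> (\<exists>R. \<forall>X\<in>V. R \<le> norm X \<longrightarrow> Q X)"
  by (auto simp: eventually_inf_principal eventually_at_infinity)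

lemma poincare_expansion_iff:
  "poincare_expansion V g c \<longleftrightarrow>
    (\<forall>N. \<exists>C R. \<forall>X\<in>V. R \<le> norm X \<longrightarrow> norm (g X - (\<Sum>m=1..N. c m / X ^ m)) \<le> C / norm X ^ Suc N)"
proof -
  have "(f \<in> O[inf at_infinity (principal V)](\<lambda>X. 1 / X ^ Suc N)) \<longleftrightarrow>
        (\<exists>C R. \<forall>X\<in>V. R \<le> norm X \<longrightarrow> norm (f X) \<le> C / norm X ^ Suc N)" for f :: "complex \<Rightarrow> complex" and N
  proof
    assume "f \<in> O[inf at_infinity (principal V)](\<lambda>X. 1 / X ^ Suc N)"
    then obtain c where "eventually (\<lambda>X. norm (f X) \<le> c * norm (1 / X ^ Suc N)) (inf at_infinity (principal V))"
      by (auto elim: landau_o.bigE)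
    then show "\<exists>C R. \<forall>X\<in>V. R \<le> norm X \<longrightarrow> norm (f X) \<le> C / norm X ^ Suc N"
      by (auto simp: eventually_inf_at_infinity norm_divide norm_power norm_mult)
  next
    assume "\<exists>C R. \<forall>X\<in>V. R \<le> norm X \<longrightarrow> norm (f X) \<le> C / norm X ^ Suc N"
    then obtain C R where "\<forall>X\<in>V. R \<le> norm X \<longrightarrow> norm (f X) \<le> C / norm X ^ Suc N" by blast
    then have "eventually (\<lambda>X. norm (f X) \<le> C * norm (1 / X ^ Suc N)) (inf at_infinity (principal V))"
      unfolding eventually_inf_at_infinity
      by (intro exI[of _ R]) (auto simp: norm_divide norm_power norm_mult)
    then show "f \<in> O[inf at_infinity (principal V)](\<lambda>X. 1 / X ^ Suc N)"
      by (rule bigoI)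
  qed
  then show ?thesis
    unfolding poincare_expansion_def by simp
qed

lemma poincare_expansion_unique:
  assumes V: "inf at_infinity (principal V) \<noteq> bot"
    and c: "poincare_expansion V g c" and d: "poincare_expansion V g d" and "c 0 = d 0"
  shows "c = d"
proof
  fix n show "c n = d n"
  proof (induction n rule: less_induct)
    case (less n)
    show ?case
    proof (cases "n = 0")
      case False
      then obtain n' where n: "n = Suc n'" using not0_implies_Suc by blast
      obtain C R where C: "\<And>X. X \<in> V \<Longrightarrow> R \<le> norm X \<Longrightarrow> norm (g X - (\<Sum>m=1..n. c m / X ^ m)) \<le> C / norm X ^ Suc n"
        using c unfolding poincare_expansion_iff by blast
      obtain C' R' where C': "\<And>X. X \<in> V \<Longrightarrow> R' \<le> norm X \<Longrightarrow> norm (g X - (\<Sum>m=1..n. d m / X ^ m)) \<le> C' / norm X ^ Suc n"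
        using d unfolding poincare_expansion_iff by blast
      show ?thesis
      proof (rule ccontr)
        assume neq: "c n \<noteq> d n"
        define B where "B = (C + C') / norm (c n - d n) + 1"
        have "\<not> eventually (\<lambda>X. False) (inf at_infinity (principal V))" using V by simp
        then obtain X where X: "X \<in> V" "max (max 1 B) (max R R') \<le> norm X"
          unfolding eventually_inf_at_infinity by blast
        have X0: "norm X > 0" using X by auto
        have eq: "(\<Sum>m=1..n. c m / X ^ m) - (\<Sum>m=1..n. d m / X ^ m) = (c n - d n) / X ^ n"
        proof -
          have "(\<Sum>m=1..n'. c m / X ^ m) = (\<Sum>m=1..n'. d m / X ^ m)"
            by (rule sum.cong) (use less n in auto)
          then show ?thesis unfolding n by (simp add: diff_divide_distrib)
        qed
        have "norm ((c n - d n) / X ^ n) \<le> C / norm X ^ Suc n + C' / norm X ^ Suc n"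
          unfolding eq[symmetric] using C[of X] C'[of X] X
            norm_triangle_ineq4[of "g X - (\<Sum>m=1..n. d m / X ^ m)" "g X - (\<Sum>m=1..n. c m / X ^ m)"]
          by auto
        then have "norm (c n - d n) * norm X \<le> C + C'"
          using X0 by (simp add: norm_divide norm_power field_simps)
        then have "norm X \<le> (C + C') / norm (c n - d n)"
          using neq by (simp add: field_simps)
        then show False using X unfolding B_def by linarith
      qed
    qed (use assms in simp)
  qed
qed

lemma asymp_coeff_eqI:
  assumes "inf at_infinity (principal V) \<noteq> bot" "poincare_expansion V g c" "c 0 = 0"
  shows "asymp_coeff V g = c"
  unfolding asymp_coeff_def
  by (rule the_equality) (use assms poincare_expansion_unique in auto)

lemma asymp_coeff_expansion:
  assumes V: "inf at_infinity (principal V) \<noteq> bot" and g: "g \<in> G_space V"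
  shows "poincare_expansion V g (asymp_coeff V g)" "asymp_coeff V g 0 = 0"
proof -
  obtain c where c: "poincare_expansion V g c" using g unfolding G_space_def by blast
  define d where "d = c(0 := 0)"
  have s: "(\<Sum>m=1..N. d m / X ^ m) = (\<Sum>m=1..N. c m / X ^ m)" for N X
    by (rule sum.cong) (auto simp: d_def)
  have d: "poincare_expansion V g d" using c unfolding poincare_expansion_def s .
  have "asymp_coeff V g = d" by (rule asymp_coeff_eqI[OF V d]) (simp add: d_def)
  with d show "poincare_expansion V g (asymp_coeff V g)" "asymp_coeff V g 0 = 0"
    by (auto simp: d_def)
qed

lemma poincare_expansion_cong:
  assumes "\<And>X. X \<in> V \<Longrightarrow> g X = h X"
  shows "poincare_expansion V g c \<longleftrightarrow> poincare_expansion V h c"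
proof -
  have "(\<forall>X\<in>V. R \<le> norm X \<longrightarrow> norm (g X - s X) \<le> e X) \<longleftrightarrow> (\<forall>X\<in>V. R \<le> norm X \<longrightarrow> norm (h X - s X) \<le> e X)" for R s e
    using assms by auto
  then show ?thesis unfolding poincare_expansion_iff by simp
qed

lemma asymp_coeff_cong:
  assumes "\<And>X. X \<in> V \<Longrightarrow> g X = h X"
  shows "asymp_coeff V g = asymp_coeff V h"
  unfolding asymp_coeff_def using poincare_expansion_cong[OF assms] by simp

lemma poincare_expansion_0: "poincare_expansion V (\<lambda>X. 0) (\<lambda>m. 0)"
  unfolding poincare_expansion_def by simp

lemma poincare_expansion_add:
  assumes "poincare_expansion V g c" "poincare_expansion V h d"
  shows "poincare_expansion V (\<lambda>X. g X + h X) (\<lambda>m. c m + d m)"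
proof -
  have e: "g X + h X - (\<Sum>m=1..N. (c m + d m) / X ^ m) =
     (g X - (\<Sum>m=1..N. c m / X ^ m)) + (h X - (\<Sum>m=1..N. d m / X ^ m))" for X N
    by (simp add: add_divide_distrib sum.distrib)
  show ?thesis using assms unfolding poincare_expansion_def e by (intro allI sum_in_bigo(1)) blast+
qed

lemma poincare_expansion_cmult:
  assumes "poincare_expansion V g c"
  shows "poincare_expansion V (\<lambda>X. k * g X) (\<lambda>m. k * c m)"
proof -
  have "k * g X - (\<Sum>m=1..N. (k * c m) / X ^ m) = k * (g X - (\<Sum>m=1..N. c m / X ^ m))" for X N
    by (simp add: right_diff_distrib sum_distrib_left)
  then show ?thesis using assms unfolding poincare_expansion_def by simp
qed

text \<open>Applied to a product of two partial sums, seen as polynomials in \<open>1/X\<close>, this discards the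
  superfluous terms of the product.\<close>

lemma bigo_poly_tail:
  fixes Q :: "complex poly"
  shows "(\<lambda>X. poly Q (1 / X) - (\<Sum>k\<le>N. coeff Q k / X ^ k)) \<in> O[inf at_infinity (principal V)](\<lambda>X. 1 / X ^ Suc N)"
proof -
  define M where "M = max N (degree Q)"
  have e: "poly Q (1 / X) - (\<Sum>k\<le>N. coeff Q k / X ^ k) = (\<Sum>k=Suc N..M. coeff Q k / X ^ k)" for X
  proof -
    have "poly Q (1 / X) = (\<Sum>k\<le>M. coeff Q k * (1 / X) ^ k)"
      unfolding poly_altdef by (rule sum.mono_neutral_left) (auto simp: M_def coeff_eq_0)
    also have "\<dots> = (\<Sum>k\<le>M. coeff Q k / X ^ k)" by (simp add: power_divide)
    also have "{..M} = {..N} \<union> {Suc N..M}" by (auto simp: M_def)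
    finally show ?thesis by (subst (asm) sum.union_disjoint) auto
  qed
  show ?thesis unfolding e
  proof (rule big_sum_in_bigo)
    fix k assume k: "k \<in> {Suc N..M}"
    show "(\<lambda>X. coeff Q k / X ^ k) \<in> O[inf at_infinity (principal V)](\<lambda>X. 1 / X ^ Suc N)"
    proof (rule bigoI[where c = "norm (coeff Q k)"], unfold eventually_inf_at_infinity, intro exI ballI impI)
      fix X :: complex assume "X \<in> V" and X: "1 \<le> norm X"
      have "norm X ^ Suc N \<le> norm X ^ k" using k X by (intro power_increasing) auto
      then show "norm (coeff Q k / X ^ k) \<le> norm (coeff Q k) * norm (1 / X ^ Suc N)"
        using X unfolding norm_divide norm_power norm_one
        by (auto simp del: power_Suc intro!: divide_left_mono mult_pos_pos zero_less_power)
    qed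
  qed
qed

lemma poincare_expansion_bigo:
  assumes "poincare_expansion V g c"
  shows "g \<in> O[inf at_infinity (principal V)](\<lambda>X. 1 / X)"
  using assms[unfolded poincare_expansion_def, rule_format, of 0] by simp

lemma poincare_expansion_mult:
  assumes c: "poincare_expansion V g c" and d: "poincare_expansion V h d" and "c 0 = 0" "d 0 = 0"
  shows "poincare_expansion V (\<lambda>X. g X * h X) (\<lambda>k. \<Sum>i\<le>k. c i * d (k - i))"
  unfolding poincare_expansion_def
proof
  fix N
  let ?F = "inf at_infinity (principal V)"
  define q where "q e = (\<Sum>k\<le>N. monom (e k) k)" for e :: "nat \<Rightarrow> complex"
  have cq: "coeff (q e) k = (if k \<le> N then e k else 0)" for e k
    by (simp add: q_def coeff_sum)
  have pq: "poly (q e) (1/X) = (\<Sum>m=1..N. e m / X ^ m)" if "e 0 = 0" for e X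
  proof -
    have "poly (q e) (1/X) = (\<Sum>k\<le>N. e k / X ^ k)"
      by (simp add: q_def poly_sum poly_monom power_divide)
    also have "\<dots> = (\<Sum>m=1..N. e m / X ^ m)"
      by (rule sum.mono_neutral_right) (use that in \<open>auto simp: not_less_eq_eq\<close>)
    finally show ?thesis .
  qed
  define Q where "Q = q c * q d"
  have cQ: "coeff Q k = (\<Sum>i\<le>k. c i * d (k - i))" if "k \<le> N" for k
    using that unfolding Q_def coeff_mult cq by (intro sum.cong) auto
  have sQ: "(\<Sum>k\<le>N. coeff Q k / X ^ k) = (\<Sum>k=1..N. (\<Sum>i\<le>k. c i * d (k - i)) / X ^ k)" for X
  proof -
    have "(\<Sum>k\<le>N. coeff Q k / X ^ k) = (\<Sum>k=1..N. coeff Q k / X ^ k)"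
      by (rule sum.mono_neutral_right) (use assms in \<open>auto simp: not_less_eq_eq cQ\<close>)
    then show ?thesis by (simp add: cQ)
  qed
  have b1: "(\<lambda>X. poly (q c) (1/X)) \<in> O[?F](\<lambda>X. 1)"
  proof -
    have "(\<lambda>X. poly (q c) (1/X) - (\<Sum>k\<le>0. coeff (q c) k / X ^ k)) \<in> O[?F](\<lambda>X. 1 / X ^ Suc 0)"
      by (rule bigo_poly_tail)
    moreover have "(\<lambda>X::complex. 1 / X ^ Suc 0) \<in> O[?F](\<lambda>X. 1)"
      by (rule bigoI[where c = 1], unfold eventually_inf_at_infinity, rule exI[of _ 1])
         (auto simp: norm_divide divide_simps)
    ultimately have "(\<lambda>X. poly (q c) (1/X) - (\<Sum>k\<le>0. coeff (q c) k / X ^ k)) \<in> O[?F](\<lambda>X. 1)"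
      by (rule landau_o.big_trans)
    then show ?thesis using assms(3) by (simp add: cq)
  qed
  have b2: "h \<in> O[?F](\<lambda>X. 1)"
  proof -
    have "(\<lambda>X::complex. 1 / X) \<in> O[?F](\<lambda>X. 1)"
      by (rule bigoI[where c = 1], unfold eventually_inf_at_infinity, rule exI[of _ 1])
         (auto simp: norm_divide divide_simps)
    then show ?thesis using poincare_expansion_bigo[OF d] landau_o.big_trans by blast
  qed
  have t1: "(\<lambda>X. (g X - poly (q c) (1/X)) * h X) \<in> O[?F](\<lambda>X. 1 / X ^ Suc N * 1)"
    by (rule landau_o.big.mult[OF _ b2]) (use c assms(3) in \<open>simp add: poincare_expansion_def pq\<close>)
  have t2: "(\<lambda>X. poly (q c) (1/X) * (h X - poly (q d) (1/X))) \<in> O[?F](\<lambda>X. 1 * (1 / X ^ Suc N))"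
    by (rule landau_o.big.mult[OF b1]) (use d assms(4) in \<open>simp add: poincare_expansion_def pq\<close>)
  have t3: "(\<lambda>X. poly Q (1/X) - (\<Sum>k\<le>N. coeff Q k / X ^ k)) \<in> O[?F](\<lambda>X. 1 / X ^ Suc N)"
    by (rule bigo_poly_tail)
  have "g X * h X - (\<Sum>k=1..N. (\<Sum>i\<le>k. c i * d (k - i)) / X ^ k) =
     (g X - poly (q c) (1/X)) * h X + poly (q c) (1/X) * (h X - poly (q d) (1/X))
      + (poly Q (1/X) - (\<Sum>k\<le>N. coeff Q k / X ^ k))" for X
    unfolding sQ by (simp add: Q_def algebra_simps)
  then show "(\<lambda>X. g X * h X - (\<Sum>k=1..N. (\<Sum>i\<le>k. c i * d (k - i)) / X ^ k)) \<in> O[?F](\<lambda>X. 1 / X ^ Suc N)"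
    using sum_in_bigo(1)[OF sum_in_bigo(1)[OF t1[unfolded mult_1_right] t2[unfolded mult_1_left]] t3]
    by (simp only:)
qed

lemma poincare_expansion_T:
  assumes c: "poincare_expansion V g c"
  shows "poincare_expansion V (\<lambda>X. X * g X - c 1) (\<lambda>m. c (Suc m))"
  unfolding poincare_expansion_iff
proof
  fix N
  obtain C R where C: "\<And>X. X \<in> V \<Longrightarrow> R \<le> norm X \<Longrightarrow>
      norm (g X - (\<Sum>m=1..Suc N. c m / X ^ m)) \<le> C / norm X ^ Suc (Suc N)"
    using c unfolding poincare_expansion_iff by blast
  have "norm (X * g X - c 1 - (\<Sum>m=1..N. c (Suc m) / X ^ m)) \<le> C / norm X ^ Suc N"
    if X: "X \<in> V" "max R 1 \<le> norm X" for X
  proof -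
    have X0: "X \<noteq> 0" using X by auto
    \<comment> \<open>The remainder of order \<open>N\<close> of \<open>T g\<close> is \<open>X\<close> times the remainder of order \<open>N + 1\<close> of \<open>g\<close>.\<close>
    have "(\<Sum>m=1..Suc N. c m / X ^ m) = c 1 / X + (\<Sum>m=Suc 1..Suc N. c m / X ^ m)"
      by (subst sum.atLeast_Suc_atMost) auto
    also have "(\<Sum>m=Suc 1..Suc N. c m / X ^ m) = (\<Sum>m=1..N. c (Suc m) / X ^ Suc m)"
      by (rule sum.shift_bounds_cl_Suc_ivl)
    finally have "X * (\<Sum>m=1..Suc N. c m / X ^ m) = X * (c 1 / X + (\<Sum>m=1..N. c (Suc m) / X ^ Suc m))"
      by simp
    also have "\<dots> = c 1 + (\<Sum>m=1..N. c (Suc m) / X ^ m)"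
      using X0 by (simp add: distrib_left sum_distrib_left)
    finally have e: "X * g X - c 1 - (\<Sum>m=1..N. c (Suc m) / X ^ m) = X * (g X - (\<Sum>m=1..Suc N. c m / X ^ m))"
      unfolding right_diff_distrib by (simp only: diff_diff_eq)
    have "norm X * norm (g X - (\<Sum>m=1..Suc N. c m / X ^ m)) \<le> norm X * (C / norm X ^ Suc (Suc N))"
      using C[of X] X by (intro mult_left_mono) auto
    then show ?thesis unfolding e using X0 by (simp add: norm_mult)
  qed
  then show "\<exists>C R. \<forall>X\<in>V. R \<le> norm X \<longrightarrow>
       norm (X * g X - c 1 - (\<Sum>m=1..N. c (Suc m) / X ^ m)) \<le> C / norm X ^ Suc N"
    by (intro exI[of _ C] exI[of _ "max R 1"]) auto
qed

lemma G_space_0: "(\<lambda>X. 0) \<in> G_space V"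
  unfolding G_space_def using poincare_expansion_0
  by (auto simp: bounded_iff intro!: exI)

lemma G_space_add: "g \<in> G_space V \<Longrightarrow> h \<in> G_space V \<Longrightarrow> (\<lambda>X. g X + h X) \<in> G_space V"
  unfolding G_space_def
  by (auto intro!: holomorphic_intros bounded_plus_comp intro: poincare_expansion_add)

lemma G_space_cmult: "g \<in> G_space V \<Longrightarrow> (\<lambda>X. k * g X) \<in> G_space V"
  unfolding G_space_def
proof (safe, goal_cases)
  case (2 c)
  then obtain B where "\<forall>X\<in>V. norm (g X) \<le> B" unfolding bounded_iff by blast
  then have "\<forall>X\<in>V. norm (k * g X) \<le> norm k * B" by (simp add: norm_mult mult_left_mono)
  then show ?case unfolding bounded_iff by blast
qed (auto intro!: holomorphic_intros intro: poincare_expansion_cmult)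

lemma G_space_sum: "(\<And>i. i \<in> I \<Longrightarrow> f i \<in> G_space V) \<Longrightarrow> (\<lambda>X. \<Sum>i\<in>I. f i X) \<in> G_space V"
  by (induction I rule: infinite_finite_induct) (auto intro: G_space_0 G_space_add)

lemma G_space_mult:
  assumes V: "inf at_infinity (principal V) \<noteq> bot" and "g \<in> G_space V" "h \<in> G_space V"
  shows "(\<lambda>X. g X * h X) \<in> G_space V"
proof -
  obtain B B' where "\<And>X. X \<in> V \<Longrightarrow> norm (g X) \<le> B" "\<And>X. X \<in> V \<Longrightarrow> norm (h X) \<le> B'"
    using assms unfolding G_space_def bounded_iff by blast
  then have "norm (g X * h X) \<le> B * B'" if "X \<in> V" for X
    unfolding norm_mult using that by (intro mult_mono) (auto intro: order_trans[OF norm_ge_zero])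
  then have "bounded ((\<lambda>X. g X * h X) ` V)" by (auto simp: bounded_iff)
  then show ?thesis
    using assms poincare_expansion_mult[OF asymp_coeff_expansion(1)[OF V] asymp_coeff_expansion(1)[OF V]
         asymp_coeff_expansion(2)[OF V] asymp_coeff_expansion(2)[OF V], of g h]
    unfolding G_space_def by (auto intro!: holomorphic_intros)
qed

lemma G_space_T:
  assumes V: "inf at_infinity (principal V) \<noteq> bot" and g: "g \<in> G_space V"
  shows "T_op V g \<in> G_space V"
    and "0 < m \<Longrightarrow> asymp_coeff V (T_op V g) m = asymp_coeff V g (Suc m)"
proof -
  have T: "T_op V g = (\<lambda>X. X * g X - asymp_coeff V g 1)" by (auto simp: T_op_def)
  have e: "poincare_expansion V (T_op V g) (\<lambda>m. asymp_coeff V g (Suc m))"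
    unfolding T by (rule poincare_expansion_T[OF asymp_coeff_expansion(1)[OF V g]])
  from e[unfolded poincare_expansion_iff, rule_format, of 0] obtain C R
    where C: "\<And>X. X \<in> V \<Longrightarrow> R \<le> norm X \<Longrightarrow> norm (T_op V g X) \<le> C / norm X" by auto
  obtain B where B: "\<And>X. X \<in> V \<Longrightarrow> norm (g X) \<le> B"
    using g unfolding G_space_def bounded_iff by blast
  have "norm (T_op V g X) \<le> max \<bar>C\<bar> (max R 1 * \<bar>B\<bar> + norm (asymp_coeff V g 1))" if X: "X \<in> V" for X
  proof (cases "max R 1 \<le> norm X")
    case True
    then have "norm (T_op V g X) \<le> C / norm X" using C X by auto
    also have "\<dots> \<le> \<bar>C\<bar> / 1" using True by (intro frac_le) auto
    finally show ?thesis by simp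
  next
    case False
    have "norm (X * g X) \<le> max R 1 * \<bar>B\<bar>"
      unfolding norm_mult using B[OF X] False by (intro mult_mono) auto
    then show ?thesis unfolding T
      using norm_triangle_ineq4[of "X * g X" "asymp_coeff V g 1"] by linarith
  qed
  then have "bounded (T_op V g ` V)" by (auto simp: bounded_iff)
  moreover have "T_op V g holomorphic_on V"
    using g unfolding T G_space_def by (auto intro!: holomorphic_intros)
  ultimately show G: "T_op V g \<in> G_space V" using e unfolding G_space_def by blast
  define d where "d = (\<lambda>m. if m = 0 then 0 else asymp_coeff V g (Suc m))"
  have s: "(\<Sum>m=1..N. d m / X ^ m) = (\<Sum>m=1..N. asymp_coeff V g (Suc m) / X ^ m)" for N X
    by (rule sum.cong) (auto simp: d_def)
  have "asymp_coeff V (T_op V g) = d"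
  proof (rule asymp_coeff_eqI[OF V])
    show "poincare_expansion V (T_op V g) d" using e unfolding poincare_expansion_def s .
  qed (simp add: d_def)
  then show "0 < m \<Longrightarrow> asymp_coeff V (T_op V g) m = asymp_coeff V g (Suc m)" by (simp add: d_def)
qed

lemma G_space_T_power:
  assumes V: "inf at_infinity (principal V) \<noteq> bot" and g: "g \<in> G_space V"
  shows "(T_op V ^^ n) g \<in> G_space V"
    and "0 < m \<Longrightarrow> asymp_coeff V ((T_op V ^^ n) g) m = asymp_coeff V g (n + m)"
proof (induction n arbitrary: m)
  case (Suc n)
  { case 1 show ?case using Suc.IH G_space_T[OF V] by simp }
  { case 2 then show ?case using Suc.IH(1) Suc.IH(2)[of "Suc m"] G_space_T(2)[OF V Suc.IH(1), of m] by simp }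
qed (use g in auto)

text \<open>For \<open>n = p - 1\<close> this identifies \<open>p T\<^sup>n g\<close> with \<open>p X\<^sup>n g\<close> minus a polynomial that only depends on the
  first \<open>p - 1\<close> coefficients of \<open>g\<close>.\<close>

lemma T_power_eq:
  assumes V: "inf at_infinity (principal V) \<noteq> bot" and g: "g \<in> G_space V"
  shows "(T_op V ^^ n) g X = X ^ n * g X - (\<Sum>\<nu>=1..n. asymp_coeff V g \<nu> * X ^ (n - \<nu>))"
proof (induction n)
  case (Suc n)
  have "(T_op V ^^ Suc n) g X = X * (T_op V ^^ n) g X - asymp_coeff V g (Suc n)"
    using G_space_T_power(2)[OF V g, of 1 n] by (simp add: T_op_def)
  also have "\<dots> = X ^ Suc n * g X - ((\<Sum>\<nu>=1..n. asymp_coeff V g \<nu> * X ^ (Suc n - \<nu>)) + asymp_coeff V g (Suc n))"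
    unfolding Suc.IH by (simp add: algebra_simps sum_distrib_left Suc_diff_le)
  finally show ?case by simp
qed simp

lemma T_power_0: 
  assumes V: "inf at_infinity (principal V) \<noteq> bot"
  shows "(T_op V ^^ n) (\<lambda>X. 0) = (\<lambda>X. 0)" "asymp_coeff V (\<lambda>X. 0) = (\<lambda>m. 0)"
proof -
  show c: "asymp_coeff V (\<lambda>X. 0) = (\<lambda>m. 0)"
    by (rule asymp_coeff_eqI[OF V poincare_expansion_0]) simp
  show "(T_op V ^^ n) (\<lambda>X. 0) = (\<lambda>X. 0)"
    by (induction n) (auto simp: T_op_def c)
qed

lemma T_power_cong:
  assumes "\<And>X. X \<in> V \<Longrightarrow> g X = h X"
  shows "X \<in> V \<Longrightarrow> (T_op V ^^ n) g X = (T_op V ^^ n) h X"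
proof (induction n arbitrary: X)
  case (Suc n)
  have "asymp_coeff V ((T_op V ^^ n) g) = asymp_coeff V ((T_op V ^^ n) h)"
    by (rule asymp_coeff_cong) (rule Suc.IH)
  then show ?case
    using Suc by (simp add: T_op_def[of V "(T_op V ^^ n) g"] T_op_def[of V "(T_op V ^^ n) h"])
qed (use assms in auto)

section \<open>Estimates for the linear equation near infinity\<close>

text \<open>Here \<open>F\<close> is a primitive of \<open>exp(-X\<^sup>p) f(X)\<close> on the part of a sector outside a disc, so that
  \<open>exp(X\<^sup>p) F(X)\<close> solves \<open>g' = p X\<^sup>p\<^sup>-\<^sup>1 g + f\<close>. The weight \<open>\<rho>\<^sup>p\<^sup>-\<^sup>1\<close> in the bound for \<open>f\<close> is the one that
  makes \<open>\<rho>\<^sup>p\<^sup>-\<^sup>1 exp(c \<rho>\<^sup>p)\<close> explicitly integrable.\<close>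

context
  fixes p K :: nat and \<alpha> \<beta> R0 C :: real and F f :: "complex \<Rightarrow> complex"
  assumes p: "0 < p" and R0: "1 \<le> R0" and C: "0 \<le> C"
    and \<alpha>: "- (3 * pi / (2 * real p)) < \<alpha>" "\<alpha> < 0" and \<beta>: "0 < \<beta>" "\<beta> < 3 * pi / (2 * real p)"
    and F: "\<And>\<rho> \<theta> :: real. R0 \<le> \<rho> \<Longrightarrow> \<alpha> < \<theta> \<Longrightarrow> \<theta> < \<beta> \<Longrightarrow>
      (F has_field_derivative exp (- (rcis \<rho> \<theta> ^ p)) * f (rcis \<rho> \<theta>)) (at (rcis \<rho> \<theta>))"
    and f: "\<And>\<rho> \<theta> :: real. R0 \<le> \<rho> \<Longrightarrow> \<alpha> < \<theta> \<Longrightarrow> \<theta> < \<beta> \<Longrightarrow> norm (f (rcis \<rho> \<theta>)) \<le> C * \<rho> ^ (p - 1) / \<rho> ^ K"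
begin

lemma norm_exp_rcis:
  fixes \<rho> \<theta> :: real
  shows "norm (exp (- (rcis \<rho> \<theta> ^ p))) = exp (- (\<rho> ^ p * cos (p * \<theta>)))"
  by (simp add: norm_exp_eq_Re DeMoivre2)

text \<open>The right-hand side is the increment of \<open>L exp(c t\<^sup>p) / t\<^sup>K\<close>, and the hypothesis on \<open>L\<close> says that the
  derivative of this function dominates that of \<open>F\<close> on the ray. It is used with \<open>c = -1\<close> and
  \<open>L = -C/p\<close> on the positive axis, and with \<open>c > 0\<close> on the rays where \<open>exp(X\<^sup>p)\<close> decays.\<close>

lemma ray_bound:
  fixes a b \<theta> c L :: real
  assumes ab: "R0 \<le> a" "a < b" and \<theta>: "\<alpha> < \<theta>" "\<theta> < \<beta>" and c: "c = - cos (p * \<theta>)"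
    and L: "\<And>t::real. a < t \<Longrightarrow> C * t ^ p \<le> L * (c * p * t ^ p - K)"
  shows "norm (F (rcis b \<theta>) - F (rcis a \<theta>)) \<le> L * exp (c * b ^ p) / b ^ K - L * exp (c * a ^ p) / a ^ K"
proof -
  define \<phi>' where "\<phi>' t = L * exp (c * t ^ p) * (c * p * t ^ p - K) / t ^ Suc K" for t :: real
  have a0: "0 < a" using ab R0 by simp
  have d\<phi>: "((\<lambda>t. L * exp (c * t ^ p) / t ^ K) has_real_derivative \<phi>' t) (at t)" if "a \<le> t" for t :: real
  proof -
    have t0: "t > 0" using that a0 by simp
    have "((\<lambda>t. L * exp (c * t ^ p) / t ^ K) has_real_derivative
       ((L * (exp (c * t ^ p) * (c * (p * t ^ (p - 1))))) * t ^ K - L * exp (c * t ^ p) * (K * t ^ (K - 1))) / (t ^ K * t ^ K)) (at t)"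
      using t0 by (auto intro!: derivative_eq_intros)
    also have "((L * (exp (c * t ^ p) * (c * (p * t ^ (p - 1))))) * t ^ K - L * exp (c * t ^ p) * (K * t ^ (K - 1))) / (t ^ K * t ^ K) = \<phi>' t"
    proof -
      obtain q where "p = Suc q" using p gr0_implies_Suc by blast
      then show ?thesis unfolding \<phi>'_def using t0 by (cases K) (simp_all add: divide_simps, simp_all add: algebra_simps)
    qed
    finally show ?thesis .
  qed
  have dF: "((\<lambda>t. F (rcis t \<theta>)) has_vector_derivative
      cis \<theta> * (exp (- (rcis t \<theta> ^ p)) * f (rcis t \<theta>))) (at t)" if "a \<le> t" for t :: real
  proof -
    have "((\<lambda>t. rcis t \<theta>) has_vector_derivative cis \<theta>) (at t)"
      unfolding rcis_def by (auto intro!: derivative_eq_intros)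
    from field_vector_diff_chain_at[OF this F[OF _ \<theta>]] show ?thesis
      using that ab by (simp add: o_def)
  qed
  have "norm ((\<lambda>t. F (rcis t \<theta>)) b - (\<lambda>t. F (rcis t \<theta>)) a) \<le>
      (\<lambda>t. L * exp (c * t ^ p) / t ^ K) b - (\<lambda>t. L * exp (c * t ^ p) / t ^ K) a"
  proof (rule differentiable_bound_general[OF \<open>a < b\<close>])
    show "continuous_on {a..b} (\<lambda>t. F (rcis t \<theta>))"
      by (intro continuous_at_imp_continuous_on ballI has_vector_derivative_continuous[OF dF]) auto
    show "continuous_on {a..b} (\<lambda>t. L * exp (c * t ^ p) / t ^ K)"
      by (intro continuous_at_imp_continuous_on ballI DERIV_isCont[OF d\<phi>]) auto
    fix t assume t: "a < t" "t < b"
    then show "((\<lambda>t. F (rcis t \<theta>)) has_vector_derivative cis \<theta> * (exp (- (rcis t \<theta> ^ p)) * f (rcis t \<theta>))) (at t)"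
      using dF by simp
    show "((\<lambda>t. L * exp (c * t ^ p) / t ^ K) has_vector_derivative \<phi>' t) (at t)"
      using d\<phi>[of t] t by (simp add: has_real_derivative_iff_has_vector_derivative)
    have t0: "t > 0" using t a0 by simp
    have "norm (cis \<theta> * (exp (- (rcis t \<theta> ^ p)) * f (rcis t \<theta>))) \<le> exp (c * t ^ p) * (C * t ^ (p - 1) / t ^ K)"
    proof -
      have "norm (cis \<theta> * (exp (- (rcis t \<theta> ^ p)) * f (rcis t \<theta>))) = exp (c * t ^ p) * norm (f (rcis t \<theta>))"
        unfolding norm_mult norm_exp_rcis c by (simp add: mult.commute)
      also have "\<dots> \<le> exp (c * t ^ p) * (C * t ^ (p - 1) / t ^ K)"
        using f[of t \<theta>] t ab \<theta> by (intro mult_left_mono) auto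
      finally show ?thesis .
    qed
    also have "\<dots> = exp (c * t ^ p) * (C * t ^ p) / t ^ Suc K"
      using t0 p by (simp add: field_simps power_eq_if)
    also have "\<dots> \<le> \<phi>' t"
    proof -
      have "exp (c * t ^ p) * (C * t ^ p) \<le> exp (c * t ^ p) * (L * (c * p * t ^ p - K))"
        using L[OF t(1)] by (intro mult_left_mono) auto
      then show ?thesis
        unfolding \<phi>'_def using t0 by (intro divide_right_mono) (auto simp: mult_ac)
    qed
    finally show "norm (cis \<theta> * (exp (- (rcis t \<theta> ^ p)) * f (rcis t \<theta>))) \<le> \<phi>' t" .
  qed
  then show ?thesis by simp
qed

lemma axis_cauchy:
  assumes "R0 \<le> a" "a \<le> b"
  shows "norm (F (of_real b) - F (of_real a)) \<le> C / p * exp (- (a ^ p)) / a ^ K"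
proof (cases "a = b")
  case False
  have "norm (F (rcis b 0) - F (rcis a 0)) \<le> (- C / p) * exp (- 1 * b ^ p) / b ^ K - (- C / p) * exp (- 1 * a ^ p) / a ^ K"
    by (rule ray_bound[where c = "- 1" and L = "- C / p"]) (use assms False \<alpha> \<beta> p C R0 in \<open>auto simp: field_simps\<close>)
  also have "\<dots> \<le> C / p * exp (- (a ^ p)) / a ^ K"
    using assms R0 C by simp
  finally show ?thesis by simp
next
  case True
  then show ?thesis using assms R0 C by simp
qed

lemma axis_limit: "\<exists>l. ((\<lambda>t. F (of_real t)) \<longlongrightarrow> l) at_top"
proof -
  have e0: "C / p * exp (- (a ^ p)) / a ^ K \<le> C * exp (- a)" if "R0 \<le> a" for a
  proof -
    have "a ^ 1 \<le> a ^ p" using that R0 p by (intro power_increasing) auto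
    then have "exp (- (a ^ p)) \<le> exp (- a)" by simp
    moreover have "C / p / a ^ K \<le> C / 1"
    proof -
      have "1 \<le> real p * a ^ K" using p that R0 by (auto intro!: mult_ge1_I)
      then have "C / (real p * a ^ K) \<le> C / 1" using C by (intro divide_left_mono) auto
      then show ?thesis by simp
    qed
    ultimately have "C / p / a ^ K * exp (- (a ^ p)) \<le> C / 1 * exp (- a)"
      using C by (intro mult_mono) auto
    then show ?thesis by (simp add: field_simps)
  qed
  have lim: "((\<lambda>a::real. C * exp (- a)) \<longlongrightarrow> C * 0) at_top"
    by (intro tendsto_intros filterlim_compose[OF exp_at_bot] filterlim_uminus_at_bot_at_top)
  have "Cauchy (\<lambda>n. F (of_real (real n)))"
  proof (rule CauchyI')
    fix e :: real assume "0 < e"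
    with lim have "eventually (\<lambda>a. C * exp (- a) < e) at_top" by (auto intro: order_tendstoD)
    then obtain N where N: "\<And>a. N \<le> a \<Longrightarrow> C * exp (- a) < e" unfolding eventually_at_top_linorder by blast
    define M where "M = nat \<lceil>max N R0\<rceil>"
    have M: "max N R0 \<le> real M" unfolding M_def by linarith
    show "\<exists>M. \<forall>m\<ge>M. \<forall>n>m. dist (F (of_real (real m))) (F (of_real (real n))) < e"
    proof (intro exI allI impI)
      fix m n assume mn: "M \<le> m" "m < n"
      then have m: "R0 \<le> real m" "N \<le> real m" using M by (auto simp: of_nat_le_iff[symmetric, where 'a=real] simp del: of_nat_le_iff)
      have "dist (F (of_real (real m))) (F (of_real (real n))) \<le> C * exp (- real m)"
        using axis_cauchy[of "real m" "real n"] e0[of "real m"] m mn by (simp add: dist_norm norm_minus_commute)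
      then show "dist (F (of_real (real m))) (F (of_real (real n))) < e" using N[of "real m"] m by linarith
    qed
  qed
  then obtain l where l: "(\<lambda>n. F (of_real (real n))) \<longlonglongrightarrow> l" using Cauchy_convergent convergent_def by blast
  have b: "norm (l - F (of_real a)) \<le> C * exp (- a)" if a: "R0 \<le> a" for a
  proof (rule tendsto_upperbound)
    show "(\<lambda>n. norm (F (of_real (real n)) - F (of_real a))) \<longlonglongrightarrow> norm (l - F (of_real a))"
      by (intro tendsto_intros l)
    show "eventually (\<lambda>n. norm (F (of_real (real n)) - F (of_real a)) \<le> C * exp (- a)) sequentially"
      using eventually_ge_at_top[of "nat \<lceil>a\<rceil>"]
    proof eventually_elim
      case (elim n)
      then have "a \<le> real n" by linarith
      then show ?case using axis_cauchy[OF a, of "real n"] e0[OF a] by linarith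
    qed
  qed simp
  have "((\<lambda>t. F (of_real t) - l) \<longlongrightarrow> 0) at_top"
  proof (rule Lim_null_comparison)
    show "eventually (\<lambda>t. norm (F (of_real t) - l) \<le> C * exp (- t)) at_top"
      using eventually_ge_at_top[of R0] by eventually_elim (use b in \<open>simp add: norm_minus_commute\<close>)
    show "((\<lambda>t. C * exp (- t)) \<longlongrightarrow> 0) at_top" using lim by simp
  qed
  then show ?thesis by (auto simp: LIM_zero_iff)
qed

lemma axis_bound:
  assumes lim: "((\<lambda>t. F (of_real t)) \<longlongrightarrow> 0) at_top" and a: "R0 \<le> a"
  shows "norm (F (of_real a)) \<le> C / p * exp (- (a ^ p)) / a ^ K"
proof -
  have "norm (0 - F (of_real a)) \<le> C / p * exp (- (a ^ p)) / a ^ K"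
  proof (rule tendsto_upperbound)
    show "((\<lambda>b. norm (F (of_real b) - F (of_real a))) \<longlongrightarrow> norm (0 - F (of_real a))) at_top"
      by (intro tendsto_intros lim)
    show "eventually (\<lambda>b. norm (F (of_real b) - F (of_real a)) \<le> C / p * exp (- (a ^ p)) / a ^ K) at_top"
      using eventually_ge_at_top[of a] by eventually_elim (rule axis_cauchy[OF a])
  qed simp
  then show ?thesis by simp
qed

text \<open>Integration along the arc of radius \<open>R\<close> from the positive axis.\<close>

lemma arc_bound:
  fixes R \<theta> B :: real
  assumes R: "R0 \<le> R" and \<theta>: "\<alpha> < \<theta>" "\<theta> < \<beta>"
    and B: "\<And>\<phi>::real. \<bar>\<phi>\<bar> \<le> \<bar>\<theta>\<bar> \<Longrightarrow> exp (- (R ^ p * cos (p * \<phi>))) * (C * R ^ (p - 1) / R ^ K) \<le> B"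
  shows "norm (F (rcis R \<theta>)) \<le> norm (F (of_real R)) + B * R * \<bar>\<theta>\<bar>"
proof -
  have "norm ((\<lambda>z. F (of_real R * exp (\<i> * z))) (of_real \<theta>) - (\<lambda>z. F (of_real R * exp (\<i> * z))) 0)
     \<le> B * R * norm (of_real \<theta> - (0::complex))"
  proof (rule field_differentiable_bound[where S = "closed_segment 0 (of_real \<theta>)"
       and f' = "\<lambda>z. exp (- ((of_real R * exp (\<i> * z)) ^ p)) * f (of_real R * exp (\<i> * z)) * (of_real R * (exp (\<i> * z) * \<i>))"])
    fix z assume "z \<in> closed_segment 0 (complex_of_real \<theta>)"
    then obtain u where u: "0 \<le> u" "u \<le> 1" "z = of_real (u * \<theta>)" by (auto simp: closed_segment_def scaleR_conv_of_real)
    define \<phi> where "\<phi> = u * \<theta>"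
    have \<phi>: "\<bar>\<phi>\<bar> \<le> \<bar>\<theta>\<bar>" unfolding \<phi>_def abs_mult using u by (simp add: mult_left_le_one_le)
    have \<phi>': "\<alpha> < \<phi>" "\<phi> < \<beta>"
    proof -
      have "\<phi> \<in> closed_segment 0 \<theta>" unfolding \<phi>_def closed_segment_def using u by auto
      then show "\<alpha> < \<phi>" "\<phi> < \<beta>" using \<theta> \<alpha> \<beta> by (auto simp: closed_segment_eq_real_ivl split: if_splits)
    qed
    have r: "of_real R * exp (\<i> * z) = rcis R \<phi>" using u by (simp add: rcis_def cis_conv_exp \<phi>_def)
    have "((\<lambda>z. of_real R * exp (\<i> * z)) has_field_derivative of_real R * (exp (\<i> * z) * \<i>)) (at z)"
      by (auto intro!: derivative_eq_intros)
    moreover have "(F has_field_derivative exp (- (rcis R \<phi> ^ p)) * f (rcis R \<phi>)) (at (of_real R * exp (\<i> * z)))"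
      unfolding r by (rule F[OF R \<phi>'])
    ultimately have "((\<lambda>z. F (of_real R * exp (\<i> * z))) has_field_derivative
      exp (- ((of_real R * exp (\<i> * z)) ^ p)) * f (of_real R * exp (\<i> * z)) * (of_real R * (exp (\<i> * z) * \<i>))) (at z)"
      unfolding r[symmetric] by (rule DERIV_chain2[rotated])
    then show "((\<lambda>z. F (of_real R * exp (\<i> * z))) has_field_derivative
      exp (- ((of_real R * exp (\<i> * z)) ^ p)) * f (of_real R * exp (\<i> * z)) * (of_real R * (exp (\<i> * z) * \<i>))) (at z within closed_segment 0 (of_real \<theta>))"
      by (rule has_field_derivative_at_within)
    have "norm (exp (- (rcis R \<phi> ^ p)) * f (rcis R \<phi>)) \<le> exp (- (R ^ p * cos (p * \<phi>))) * (C * R ^ (p - 1) / R ^ K)"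
      unfolding norm_mult norm_exp_rcis using f[OF R \<phi>'] by (intro mult_left_mono) auto
    also have "\<dots> \<le> B" by (rule B[OF \<phi>])
    finally have "norm (exp (- (rcis R \<phi> ^ p)) * f (rcis R \<phi>)) * R \<le> B * R"
      using R R0 by (intro mult_right_mono) auto
    moreover have "norm (of_real R * (exp (\<i> * z) * \<i>)) = R"
      using u R R0 by (simp add: norm_mult norm_exp_eq_Re)
    ultimately show "norm (exp (- ((of_real R * exp (\<i> * z)) ^ p)) * f (of_real R * exp (\<i> * z)) * (of_real R * (exp (\<i> * z) * \<i>))) \<le> B * R"
      unfolding r by (subst norm_mult) simp
  qed auto
  moreover have "of_real R * exp (\<i> * of_real \<theta>) = rcis R \<theta>" by (simp add: rcis_def cis_conv_exp)
  ultimately have "norm (F (rcis R \<theta>) - F (of_real R)) \<le> B * R * \<bar>\<theta>\<bar>" by simp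
  then show ?thesis using norm_triangle_ineq2[of "F (rcis R \<theta>)" "F (of_real R)"] by linarith
qed

text \<open>For \<open>\<bar>\<theta>\<bar> \<le> \<pi>/p\<close> the arc from the axis is used: \<open>cos(p \<phi>)\<close> decreases in \<open>\<bar>\<phi>\<bar>\<close> there, so
  \<open>\<bar>exp(X\<^sup>p - t\<^sup>p)\<bar> \<le> 1\<close> on the arc, at the price of its length. For larger \<open>\<bar>\<theta>\<bar>\<close> this monotonicity is
  lost, but \<open>-cos(p \<theta>)\<close> is bounded below by a positive constant because \<open>\<alpha>\<close> and \<open>\<beta>\<close> stay away from
  \<open>\<plusminus>3\<pi>/(2p)\<close>; so the values on a fixed circle are damped when moving outwards along the ray.\<close>

lemma decay_bound:
  assumes lim: "((\<lambda>t. F (of_real t)) \<longlongrightarrow> 0) at_top"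
  shows "\<exists>C' R1. R0 \<le> R1 \<and> (\<forall>\<rho> \<theta> :: real. R1 \<le> \<rho> \<longrightarrow> \<alpha> < \<theta> \<longrightarrow> \<theta> < \<beta> \<longrightarrow>
           norm (exp (rcis \<rho> \<theta> ^ p) * F (rcis \<rho> \<theta>)) \<le> C' * \<rho> ^ p / \<rho> ^ K)"
proof -
  \<comment> \<open>\<open>c0\<close> is a lower bound of \<open>-cos(p \<theta>)\<close> over \<open>\<pi>/p \<le> \<bar>\<theta>\<bar> \<le> max (-\<alpha>) \<beta>\<close>.\<close>
  define m where "m = max pi (p * max (- \<alpha>) \<beta>)"
  define c0 where "c0 = - cos m"
  have m: "pi \<le> m" "m < 3 * pi / 2"
    using \<alpha> \<beta> p by (auto simp: m_def field_simps max_def)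
  have cosm: "- cos x = cos (x - pi)" for x :: real by (simp add: cos_diff)
  have c0: "0 < c0" unfolding c0_def cosm using m by (intro cos_gt_zero_pi) auto
  \<comment> \<open>Beyond \<open>R1\<close> the factor \<open>exp(c t\<^sup>p)\<close> wins over \<open>1/t\<^sup>K\<close>, as required by \<open>ray_bound\<close>.\<close>
  define R1 where "R1 = max R0 (2 * K / (c0 * p))"
  have R1: "R0 \<le> R1" "1 \<le> R1" "2 * K \<le> c0 * p * R1"
  proof -
    show "R0 \<le> R1" by (simp add: R1_def)
    then show "1 \<le> R1" using R0 by linarith
    have "2 * K / (c0 * p) \<le> R1" by (simp add: R1_def)
    then show "2 * K \<le> c0 * p * R1" using c0 p by (simp add: field_simps)
  qed
  define B where "B = exp (R1 ^ p) * (C * R1 ^ (p - 1) / R1 ^ K)"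
  define B0 where "B0 = C / p * exp (- (R1 ^ p)) / R1 ^ K + B * R1 * (2 * pi)"
  have B: "0 \<le> B" using C R1 by (simp add: B_def)
  have B0: "norm (F (rcis R1 \<theta>)) \<le> B0" if \<theta>: "\<alpha> < \<theta>" "\<theta> < \<beta>" for \<theta> :: real
  proof -
    have "norm (F (rcis R1 \<theta>)) \<le> norm (F (of_real R1)) + B * R1 * \<bar>\<theta>\<bar>"
    proof (rule arc_bound[OF R1(1) \<theta>])
      fix \<phi> :: real
      have "R1 ^ p * (- cos (p * \<phi>)) \<le> R1 ^ p * 1"
        using R1 cos_ge_minus_one[of "p * \<phi>"] by (intro mult_left_mono) auto
      then show "exp (- (R1 ^ p * cos (p * \<phi>))) * (C * R1 ^ (p - 1) / R1 ^ K) \<le> B"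
        unfolding B_def using C R1 by (intro mult_right_mono) auto
    qed
    also have "norm (F (of_real R1)) \<le> C / p * exp (- (R1 ^ p)) / R1 ^ K"
      by (rule axis_bound[OF lim R1(1)])
    also have "B * R1 * \<bar>\<theta>\<bar> \<le> B * R1 * (2 * pi)"
    proof (rule mult_left_mono)
      have "3 * pi / (2 * real p) \<le> 3 * pi / 2" using p by (intro divide_left_mono) auto
      then show "\<bar>\<theta>\<bar> \<le> 2 * pi" using \<theta> \<alpha> \<beta> pi_gt_zero by linarith
    qed (use B R1 in auto)
    finally show ?thesis unfolding B0_def by simp
  qed
  \<comment> \<open>The first term is for the inhomogeneity, the second one absorbs the values on the circle of radius \<open>R1\<close>.\<close>
  define L where "L = max (2 * C / (c0 * p)) (B0 * R1 ^ K)"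
  have L0: "0 \<le> L" using C c0 by (simp add: L_def le_max_iff_disj)
  define C' where "C' = max L (C / p + C * pi / p)"
  have C'0: "0 \<le> C'" using L0 unfolding C'_def by simp
  have "norm (exp (rcis \<rho> \<theta> ^ p) * F (rcis \<rho> \<theta>)) \<le> C' * \<rho> ^ p / \<rho> ^ K"
    if \<rho>: "R1 \<le> \<rho>" and \<theta>: "\<alpha> < \<theta>" "\<theta> < \<beta>" for \<rho> \<theta> :: real
  proof -
    have \<rho>0: "1 \<le> \<rho>" "R0 \<le> \<rho>" using \<rho> R1 by auto
    have \<rho>p: "1 \<le> \<rho> ^ p" using \<rho>0 by simp
    have ne: "norm (exp (rcis \<rho> \<theta> ^ p)) = exp (\<rho> ^ p * cos (p * \<theta>))"
      by (simp add: norm_exp_eq_Re DeMoivre2)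
    show ?thesis
    proof (cases "\<bar>\<theta>\<bar> \<le> pi / p")
      case True
      define D where "D = C * \<rho> ^ (p - 1) / \<rho> ^ K"
      have D0: "0 \<le> D" using C \<rho>0 by (simp add: D_def)
      have "norm (F (rcis \<rho> \<theta>)) \<le> norm (F (of_real \<rho>)) + exp (- (\<rho> ^ p * cos (p * \<theta>))) * D * \<rho> * \<bar>\<theta>\<bar>"
      proof (rule arc_bound[OF \<rho>0(2) \<theta>])
        fix \<phi> :: real assume \<phi>: "\<bar>\<phi>\<bar> \<le> \<bar>\<theta>\<bar>"
        have "cos (p * \<bar>\<theta>\<bar>) \<le> cos (p * \<bar>\<phi>\<bar>)"
          using \<phi> True p by (intro cos_monotone_0_pi_le) (auto simp: field_simps mult_left_mono)
        then have "cos (p * \<theta>) \<le> cos (p * \<phi>)" by (simp add: abs_if split: if_splits)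
        then have "\<rho> ^ p * cos (p * \<theta>) \<le> \<rho> ^ p * cos (p * \<phi>)" using \<rho>0 by (intro mult_left_mono) auto
        then show "exp (- (\<rho> ^ p * cos (p * \<phi>))) * (C * \<rho> ^ (p - 1) / \<rho> ^ K) \<le> exp (- (\<rho> ^ p * cos (p * \<theta>))) * D"
          using D0 unfolding D_def by (intro mult_right_mono) auto
      qed
      then have "exp (\<rho> ^ p * cos (p * \<theta>)) * norm (F (rcis \<rho> \<theta>)) \<le>
          exp (\<rho> ^ p * cos (p * \<theta>)) * (norm (F (of_real \<rho>)) + exp (- (\<rho> ^ p * cos (p * \<theta>))) * D * \<rho> * \<bar>\<theta>\<bar>)"
        by (intro mult_left_mono) auto
      also have "\<dots> = exp (\<rho> ^ p * cos (p * \<theta>)) * norm (F (of_real \<rho>)) + D * \<rho> * \<bar>\<theta>\<bar>"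
        by (simp add: exp_minus field_simps)
      also have "exp (\<rho> ^ p * cos (p * \<theta>)) * norm (F (of_real \<rho>)) \<le> exp (\<rho> ^ p) * (C / p * exp (- (\<rho> ^ p)) / \<rho> ^ K)"
        using axis_bound[OF lim \<rho>0(2)] \<rho>0 by (intro mult_mono) (auto simp: mult_left_le)
      also have "\<dots> = C / p * 1 / \<rho> ^ K" by (simp add: exp_minus field_simps)
      also have "\<dots> \<le> C / p * \<rho> ^ p / \<rho> ^ K"
        using \<rho>p C \<rho>0 by (intro divide_right_mono mult_left_mono) auto
      also have "D * \<rho> * \<bar>\<theta>\<bar> \<le> D * \<rho> * (pi / p)"
        using True D0 \<rho>0 by (intro mult_left_mono) auto
      also have "D * \<rho> * (pi / p) = C * pi / p * \<rho> ^ p / \<rho> ^ K"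
        unfolding D_def using p by (simp add: power_eq_if field_simps)
      finally have "exp (\<rho> ^ p * cos (p * \<theta>)) * norm (F (rcis \<rho> \<theta>)) \<le> (C / p + C * pi / p) * \<rho> ^ p / \<rho> ^ K"
        by (simp add: add_divide_distrib distrib_right)
      also have "\<dots> \<le> C' * \<rho> ^ p / \<rho> ^ K"
        using \<rho>0 by (intro divide_right_mono mult_right_mono) (auto simp: C'_def)
      finally show ?thesis unfolding norm_mult ne .
    next
      case False
      define c where "c = - cos (p * \<theta>)"
      have "c0 \<le> c"
      proof -
        have a: "pi \<le> p * \<bar>\<theta>\<bar>" using False p by (simp add: field_simps)
        have b: "p * \<bar>\<theta>\<bar> \<le> m"
        proof -
          have "\<bar>\<theta>\<bar> \<le> max (- \<alpha>) \<beta>" using \<theta> by auto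
          then show ?thesis unfolding m_def by (intro max.coboundedI2[OF mult_left_mono]) auto
        qed
        have "cos (m - pi) \<le> cos (p * \<bar>\<theta>\<bar> - pi)"
          using a b m by (intro cos_monotone_0_pi_le) auto
        moreover have "cos (p * \<bar>\<theta>\<bar>) = cos (p * \<theta>)" by (simp add: abs_if)
        ultimately show ?thesis unfolding c0_def c_def cosm[symmetric] by simp
      qed
      have main: "norm (F (rcis \<rho> \<theta>)) \<le> L * exp (c * \<rho> ^ p) / \<rho> ^ K"
      proof -
        have bL: "B0 \<le> L * exp (c * R1 ^ p) / R1 ^ K"
        proof -
          have "B0 \<le> L / R1 ^ K" using R1 by (simp add: L_def field_simps)
          also have "\<dots> \<le> L * exp (c * R1 ^ p) / R1 ^ K"
            using L0 R1 c0 \<open>c0 \<le> c\<close> by (intro divide_right_mono) (auto simp: mult_le_cancel_left1)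
          finally show ?thesis .
        qed
        show ?thesis
        proof (cases "\<rho> = R1")
          case True
          then show ?thesis using B0[OF \<theta>] bL by simp
        next
          case False
          have "norm (F (rcis \<rho> \<theta>) - F (rcis R1 \<theta>)) \<le> L * exp (c * \<rho> ^ p) / \<rho> ^ K - L * exp (c * R1 ^ p) / R1 ^ K"
          proof (rule ray_bound[OF R1(1) _ \<theta> c_def])
            show "R1 < \<rho>" using False \<rho> by simp
            fix t assume t: "R1 < t"
            have "t ^ 1 \<le> t ^ p" using t R1 p by (intro power_increasing) auto
            then have "c0 * p * R1 \<le> c0 * p * t ^ p" using t c0 p by (intro mult_left_mono) auto
            also have "\<dots> \<le> c * p * t ^ p" using t R1 \<open>c0 \<le> c\<close> by (intro mult_right_mono) auto
            finally have K: "real K \<le> c * p * t ^ p / 2" using R1 by linarith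
            have "C * t ^ p = 2 * C / (c0 * p) * (c0 * p * t ^ p / 2)" using c0 p by simp
            also have "\<dots> \<le> L * (c * p * t ^ p / 2)"
              using \<open>c0 \<le> c\<close> c0 t R1 L0 C
              by (intro mult_mono divide_right_mono mult_right_mono) (auto simp: L_def)
            also have "\<dots> \<le> L * (c * p * t ^ p - K)"
              using K L0 by (intro mult_left_mono) auto
            finally show "C * t ^ p \<le> L * (c * p * t ^ p - K)" .
          qed
          then show ?thesis using B0[OF \<theta>] bL norm_triangle_ineq2[of "F (rcis \<rho> \<theta>)" "F (rcis R1 \<theta>)"] by linarith
        qed
      qed
      have "norm (exp (rcis \<rho> \<theta> ^ p) * F (rcis \<rho> \<theta>)) \<le> exp (- (c * \<rho> ^ p)) * (L * exp (c * \<rho> ^ p) / \<rho> ^ K)"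
      proof -
        have "exp (\<rho> ^ p * cos (p * \<theta>)) = exp (- (c * \<rho> ^ p))" by (simp add: c_def mult.commute)
        then show ?thesis unfolding norm_mult ne using main by (simp only: mult_left_mono exp_ge_zero)
      qed
      also have "\<dots> = L * 1 / \<rho> ^ K" by (simp add: exp_minus field_simps)
      also have "\<dots> \<le> C' * \<rho> ^ p / \<rho> ^ K"
        using \<rho>0 \<rho>p L0 by (intro divide_right_mono mult_mono) (auto simp: C'_def)
      finally show ?thesis .
    qed
  qed
  then show ?thesis using R1 by blast
qed

end

section \<open>The linear equation on a quasi-sector\<close>

text \<open>If \<open>k\<^sub>m\<close> are the coefficients of \<open>X\<^sup>-\<^sup>m\<close> in \<open>X\<^sup>1\<^sup>-\<^sup>p f\<close>, these are the coefficients of the formal solution in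
  \<open>1/X\<close> of \<open>g' = p X\<^sup>p\<^sup>-\<^sup>1 g + f\<close>.\<close>

fun formal_solution_coeff :: "nat \<Rightarrow> (nat \<Rightarrow> complex) \<Rightarrow> nat \<Rightarrow> complex" where
  "formal_solution_coeff p k m = (if m = 0 \<or> p = 0 then 0
     else - (k m + (if p \<le> m then of_nat (m - p) * formal_solution_coeff p k (m - p) else 0)) / of_nat p)"

declare formal_solution_coeff.simps [simp del]

context
  fixes p :: nat and \<alpha> \<beta> \<mu> :: real and V :: "complex set"
  assumes p: "2 \<le> p" and \<mu>: "\<mu> \<noteq> 0"
    and \<alpha>: "- (3 * pi / (2 * real p)) < \<alpha>" "\<alpha> < 0" and \<beta>: "0 < \<beta>" "\<beta> < 3 * pi / (2 * real p)"
    and V: "V = quasi_sector \<alpha> \<beta> \<infinity> \<mu>"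
begin

lemma angles: "- pi < \<alpha>" "\<beta> < pi"
proof -
  have "3 * pi / (2 * real p) \<le> 3 * pi / (2 * 2)" using p by (intro divide_left_mono) auto
  then show "- pi < \<alpha>" "\<beta> < pi" using \<alpha> \<beta> pi_gt_zero by auto
qed

lemma mem_V: "X \<in> V \<longleftrightarrow> (if 0 < \<mu> then (\<alpha> < Arg X \<and> Arg X < \<beta>) \<or> norm X < \<mu> else - \<mu> < norm X \<and> \<alpha> < Arg X \<and> Arg X < \<beta>)"
  by (simp add: V quasi_sector_def)

lemma polar_V:
  assumes "X \<in> V" "\<bar>\<mu>\<bar> \<le> norm X"
  shows "\<alpha> < Arg X" "Arg X < \<beta>" "X = rcis (norm X) (Arg X)"
  using assms by (auto simp: mem_V rcis_cmod_Arg split: if_splits)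

lemma rcis_V:
  assumes "\<bar>\<mu>\<bar> < \<rho>" "\<alpha> < \<theta>" "\<theta> < \<beta>"
  shows "rcis \<rho> \<theta> \<in> V"
proof -
  have "Arg (rcis \<rho> \<theta>) = \<theta>" using assms angles by (intro Arg_rcis) auto
  then show ?thesis using assms by (auto simp: mem_V)
qed

lemma of_real_V: "\<bar>\<mu>\<bar> < t \<Longrightarrow> of_real t \<in> V"
  using rcis_V[of t 0] \<alpha> \<beta> by simp

lemma filter_V: "inf at_infinity (principal V) \<noteq> bot"
proof
  assume "inf at_infinity (principal V) = bot"
  then have "eventually (\<lambda>X. False) (inf at_infinity (principal V))" by simp
  then obtain R where R: "\<And>X. X \<in> V \<Longrightarrow> R \<le> norm X \<Longrightarrow> False" unfolding eventually_inf_at_infinity by blast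
  show False using R[of "of_real (\<bar>R\<bar> + \<bar>\<mu>\<bar> + 1)"] of_real_V[of "\<bar>R\<bar> + \<bar>\<mu>\<bar> + 1"]
    unfolding norm_of_real by linarith
qed

lemma not_nonpos_Reals:
  assumes "\<alpha> < Arg X" "Arg X < \<beta>" "X \<noteq> 0"
  shows "X \<notin> \<real>\<^sub>\<le>\<^sub>0"
proof
  assume "X \<in> \<real>\<^sub>\<le>\<^sub>0"
  then obtain r where "X = of_real r" "r \<le> 0" by (auto elim: nonpos_Reals_cases)
  then show False using assms angles by (auto split: if_splits)
qed

lemma open_V: "open V"
proof -
  have o: "open (- \<real>\<^sub>\<le>\<^sub>0 \<inter> Arg -` {\<alpha><..<\<beta>})"
    by (rule continuous_open_preimage[OF continuous_on_Arg]) (auto simp: closed_nonpos_Reals_complex)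
  show ?thesis
  proof (cases "0 < \<mu>")
    case True
    have "V = ball 0 \<mu> \<union> (- \<real>\<^sub>\<le>\<^sub>0 \<inter> Arg -` {\<alpha><..<\<beta>})"
    proof (intro set_eqI iffI)
      fix X assume "X \<in> V"
      then show "X \<in> ball 0 \<mu> \<union> (- \<real>\<^sub>\<le>\<^sub>0 \<inter> Arg -` {\<alpha><..<\<beta>})"
        using True not_nonpos_Reals[of X] by (cases "X = 0") (auto simp: mem_V)
    qed (use True in \<open>auto simp: mem_V\<close>)
    then show ?thesis using o by auto
  next
    case False
    then have "V = (- cball 0 (- \<mu>)) \<inter> (- \<real>\<^sub>\<le>\<^sub>0 \<inter> Arg -` {\<alpha><..<\<beta>})"
    proof (intro set_eqI iffI)
      fix X assume "X \<in> V"
      then show "X \<in> (- cball 0 (- \<mu>)) \<inter> (- \<real>\<^sub>\<le>\<^sub>0 \<inter> Arg -` {\<alpha><..<\<beta>})"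
        using False \<mu> not_nonpos_Reals[of X] by (cases "X = 0") (auto simp: mem_V)
    qed (auto simp: mem_V)
    then show ?thesis using o by (auto intro!: open_Int)
  qed
qed

text \<open>For \<open>\<mu> > 0\<close> the quasi-sector is starlike about \<open>0\<close>; for \<open>\<mu> < 0\<close> the logarithm maps it onto a convex
  set.\<close>

lemma simply_connected_V: "simply_connected V"
proof (cases "0 < \<mu>")
  case True
  have "starlike V" unfolding starlike_def
  proof (intro bexI ballI subsetI)
    show "0 \<in> V" using True by (simp add: mem_V)
    fix x y assume x: "x \<in> V" and "y \<in> closed_segment 0 x"
    then obtain u where u: "0 \<le> u" "u \<le> 1" "y = of_real u * x" by (auto simp: closed_segment_def scaleR_conv_of_real)
    show "y \<in> V"
    proof (cases "u = 0")
      case False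
      then have "norm y \<le> norm x" "Arg y = Arg x" using u by (auto simp: norm_mult mult_left_le_one_le)
      then show ?thesis using x True by (auto simp: mem_V)
    qed (use u True in \<open>simp add: mem_V\<close>)
  qed
  then show ?thesis by (rule starlike_imp_simply_connected)
next
  case False
  define W where "W = {w. ln (- \<mu>) < Re w} \<inter> ({w. \<alpha> < Im w} \<inter> {w. Im w < \<beta>})"
  have "convex W" unfolding W_def
    by (intro convex_Int convex_halfspace_Re_gt convex_halfspace_Im_gt convex_halfspace_Im_lt)
  moreover have "W homeomorphic V"
  proof (rule homeomorphicI[where f = exp and g = Ln])
    have \<mu>0: "0 < - \<mu>" using False \<mu> by simp
    have A: "Arg (exp w) = Im w" "Ln (exp w) = w" if "w \<in> W" for w
      using that angles unfolding W_def by (auto simp: Arg_exp)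
    have B: "exp w \<in> V" if "w \<in> W" for w
    proof -
      have "- \<mu> < exp (Re w)" using that \<mu>0 unfolding W_def by (metis (no_types, lifting) Int_iff exp_less_mono exp_ln mem_Collect_eq)
      then show ?thesis using A[OF that] that False by (simp add: mem_V W_def norm_exp_eq_Re)
    qed
    have D: "Ln X \<in> W" "exp (Ln X) = X" if "X \<in> V" for X
    proof -
      have X: "- \<mu> < norm X" "X \<noteq> 0" "\<alpha> < Arg X" "Arg X < \<beta>" using that False \<mu>0 by (auto simp: mem_V)
      then show "exp (Ln X) = X" by simp
      have "ln (- \<mu>) < ln (norm X)" using X \<mu>0 by simp
      then show "Ln X \<in> W" using X by (simp add: W_def Arg_eq_Im_Ln)
    qed
    show "exp ` W = V" using B D by (force intro: image_eqI[of _ _ "Ln _"])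
    show "Ln ` V = W" using B D A by (force intro: image_eqI[of _ _ "exp _"])
    show "continuous_on V Ln"
    proof (rule continuous_on_Ln)
      fix X assume "X \<in> V"
      then show "X \<notin> \<real>\<^sub>\<le>\<^sub>0" using False \<mu>0 by (intro not_nonpos_Reals) (auto simp: mem_V)
    qed
    show "\<And>w. w \<in> W \<Longrightarrow> Ln (exp w) = w" by (rule A(2))
    show "\<And>X. X \<in> V \<Longrightarrow> exp (Ln X) = X" by (rule D(2))
  qed (auto intro!: continuous_intros)
  ultimately show ?thesis
    using convex_imp_simply_connected homeomorphic_simply_connected by blast
qed

lemma primitive_V:
  assumes "f holomorphic_on V"
  obtains F where "\<And>X. X \<in> V \<Longrightarrow> (F has_field_derivative f X) (at X)"
  using simply_connected_V assms unfolding simply_connected_eq_global_primitive[OF open_V] by blast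

text \<open>Each point can be joined by a segment of bounded length either to the circle of radius \<open>R\<close>
  (radially, if its argument is between \<open>\<alpha>\<close> and \<open>\<beta>\<close>) or to \<open>0\<close>. This gives bounds up to the boundary
  of \<open>V\<close>, where \<open>F\<close> need not extend continuously.\<close>

lemma bounded_primitive:
  assumes F: "\<And>X. X \<in> V \<Longrightarrow> (F has_field_derivative f X) (at X)" and R: "\<bar>\<mu>\<bar> < R"
    and B: "\<And>X. X \<in> V \<Longrightarrow> norm X \<le> R \<Longrightarrow> norm (f X) \<le> B"
    and B1: "\<And>X. X \<in> V \<Longrightarrow> norm X = R \<Longrightarrow> norm (F X) \<le> B1"
  shows "\<exists>B2. \<forall>X\<in>V. norm X \<le> R \<longrightarrow> norm (F X) \<le> B2"
proof -
  have B0: "0 \<le> B" using order_trans[OF norm_ge_zero B[of "of_real ((\<bar>\<mu>\<bar> + R) / 2)"]]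
      of_real_V[of "(\<bar>\<mu>\<bar> + R) / 2"] R unfolding norm_of_real by auto
  have near: "norm (F X) \<le> norm (F 0) + B * \<mu>" if "0 < \<mu>" "norm X < \<mu>" for X
  proof -
    have s: "ball 0 \<mu> \<subseteq> V"
    proof
      fix z :: complex assume "z \<in> ball 0 \<mu>"
      then show "z \<in> V" unfolding mem_V using that(1) by simp
    qed
    have "norm (F X - F 0) \<le> B * norm (X - 0)"
    proof (rule field_differentiable_bound[OF convex_ball[of 0 \<mu>], where f' = f])
      fix z :: complex assume z: "z \<in> ball 0 \<mu>"
      with s show "(F has_field_derivative f z) (at z within ball 0 \<mu>)"
        by (auto intro: has_field_derivative_at_within[OF F])
      show "norm (f z) \<le> B" using z s R by (intro B) auto
    qed (use that in auto)
    also have "\<dots> \<le> B * \<mu>" using that B0 by (intro mult_left_mono) auto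
    finally show ?thesis using norm_triangle_ineq2[of "F X" "F 0"] by linarith
  qed
  have far: "norm (F X) \<le> B1 + B * R" if X: "X \<in> V" "norm X \<le> R" and n: "\<not> (0 < \<mu> \<and> norm X < \<mu>)" for X
  proof -
    have \<theta>: "\<alpha> < Arg X" "Arg X < \<beta>" and X0: "0 < norm X" using X n \<mu> by (auto simp: mem_V split: if_splits)
    define Y where "Y = rcis R (Arg X)"
    have seg: "z \<in> V \<and> norm z \<le> R" if z: "z \<in> closed_segment X Y" for z
    proof -
      obtain u where u: "0 \<le> u" "u \<le> 1" "z = (1 - u) *\<^sub>R X + u *\<^sub>R Y" using z by (auto simp: closed_segment_def)
      define \<rho> where "\<rho> = (1 - u) * norm X + u * R"
      have "z = (1 - u) *\<^sub>R rcis (norm X) (Arg X) + u *\<^sub>R Y" using u by (simp add: rcis_cmod_Arg)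
      then have z': "z = rcis \<rho> (Arg X)" by (simp add: Y_def \<rho>_def rcis_def scaleR_conv_of_real algebra_simps)
      have "norm X + u * (R - norm X) = \<rho>" by (simp add: \<rho>_def algebra_simps)
      moreover have "0 \<le> u * (R - norm X)" "u * (R - norm X) \<le> R - norm X"
        using u X mult_right_mono[of u 1 "R - norm X"] by auto
      ultimately have \<rho>: "norm X \<le> \<rho>" "\<rho> \<le> R" by linarith+
      then have "\<rho> > 0" using X0 by linarith
      then have "Arg z = Arg X" unfolding z' using \<theta> angles by (intro Arg_rcis) auto
      moreover have "norm z = \<rho>" using \<open>\<rho> > 0\<close> by (simp add: z')
      ultimately show ?thesis using X \<theta> \<rho> by (auto simp: mem_V split: if_splits)
    qed
    have "norm (F X - F Y) \<le> B * norm (X - Y)"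
    proof (rule field_differentiable_bound[OF convex_closed_segment[of X Y], where f' = f])
      fix z assume z: "z \<in> closed_segment X Y"
      with seg show "(F has_field_derivative f z) (at z within closed_segment X Y)"
        by (auto intro: has_field_derivative_at_within[OF F])
      show "norm (f z) \<le> B" using z seg by (intro B) auto
    qed auto
    also have "norm (X - Y) \<le> R"
    proof -
      have "X - Y = rcis (norm X) (Arg X) - Y" by (simp add: rcis_cmod_Arg)
      also have "\<dots> = rcis (norm X - R) (Arg X)" by (simp add: Y_def rcis_def algebra_simps)
      finally have "norm (X - Y) = \<bar>norm X - R\<bar>" by (simp only: complex_mod_rcis)
      then show ?thesis using X X0 by linarith
    qed
    finally have "norm (F X - F Y) \<le> B * R" using B0 by (simp add: mult_left_mono order_trans)
    moreover have "norm (F Y) \<le> B1" using seg[of Y] R by (intro B1) (auto simp: Y_def)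
    ultimately show ?thesis using norm_triangle_ineq2[of "F X" "F Y"] by linarith
  qed
  show ?thesis
    by (rule exI[of _ "max (norm (F 0) + B * \<mu>) (B1 + B * R)"]) (use near far in \<open>force simp: le_max_iff_disj\<close>)
qed

text \<open>The inhomogeneity is \<open>f = h - p \<Sum>\<^sub>\<nu> c\<^sub>\<nu> X\<^sup>p\<^sup>-\<^sup>1\<^sup>-\<^sup>\<nu>\<close>. The polynomial part enforces the leading
  coefficients: as \<open>g'\<close> is small, \<open>p X\<^sup>p\<^sup>-\<^sup>1 g\<close> has to agree with \<open>-f\<close> at leading orders.\<close>

lemma linear_equation_exists:
  assumes h: "h \<in> G_space V"
  shows "\<exists>g\<in>G_space V. (\<forall>\<nu>\<in>{1..p-1}. asymp_coeff V g \<nu> = c \<nu>) \<and>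
     (\<forall>X\<in>V. (g has_field_derivative of_nat p * (T_op V ^^ (p - 1)) g X + h X) (at X))"
proof -
  define hc where "hc = asymp_coeff V h"
  have hc: "poincare_expansion V h hc" "hc 0 = 0"
    using asymp_coeff_expansion[OF filter_V h] by (auto simp: hc_def)
  obtain Bh where Bh: "\<And>X. X \<in> V \<Longrightarrow> norm (h X) \<le> Bh" using h unfolding G_space_def bounded_iff by blast
  have hol: "h holomorphic_on V" using h unfolding G_space_def by blast
  define f where "f X = h X - of_nat p * (\<Sum>\<nu>=1..p-1. c \<nu> * X ^ (p - 1 - \<nu>))" for X
  have "(\<lambda>X. exp (- (X ^ p)) * f X) holomorphic_on V"
    unfolding f_def by (intro holomorphic_intros hol)
  then obtain F0 where F0: "\<And>X. X \<in> V \<Longrightarrow> (F0 has_field_derivative exp (- (X ^ p)) * f X) (at X)"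
    using primitive_V by blast
  define R0 where "R0 = \<bar>\<mu>\<bar> + 1"
  have R0: "1 \<le> R0" "\<bar>\<mu>\<bar> < R0" by (auto simp: R0_def)
  have rV: "rcis \<rho> \<theta> \<in> V" if "R0 \<le> \<rho>" "\<alpha> < \<theta>" "\<theta> < \<beta>" for \<rho> \<theta>
    using that R0 by (intro rcis_V) auto
  define Cf where "Cf = \<bar>Bh\<bar> + real p * (\<Sum>\<nu>=1..p-1. norm (c \<nu>))"
  have Cf0: "0 \<le> Cf" unfolding Cf_def by (intro add_nonneg_nonneg mult_nonneg_nonneg sum_nonneg) auto
  have f_bound: "norm (f X) \<le> Cf * r ^ (p - 1)" if X: "X \<in> V" "norm X \<le> r" "1 \<le> r" for X r
  proof -
    have r1: "1 \<le> r ^ (p - 1)" using X by simp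
    have "norm (\<Sum>\<nu>=1..p-1. c \<nu> * X ^ (p - 1 - \<nu>)) \<le> (\<Sum>\<nu>=1..p-1. norm (c \<nu>) * r ^ (p - 1))"
    proof (rule sum_norm_le)
      fix \<nu> assume "\<nu> \<in> {1..p-1}"
      have "norm X ^ (p - 1 - \<nu>) \<le> r ^ (p - 1 - \<nu>)" using X by (intro power_mono) auto
      also have "\<dots> \<le> r ^ (p - 1)" using X by (intro power_increasing) auto
      finally show "norm (c \<nu> * X ^ (p - 1 - \<nu>)) \<le> norm (c \<nu>) * r ^ (p - 1)"
        by (simp add: norm_mult norm_power mult_left_mono)
    qed
    then have "norm (of_nat p * (\<Sum>\<nu>=1..p-1. c \<nu> * X ^ (p - 1 - \<nu>))) \<le> real p * ((\<Sum>\<nu>=1..p-1. norm (c \<nu>)) * r ^ (p - 1))"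
      unfolding norm_mult norm_of_nat by (intro mult_left_mono) (auto simp: sum_distrib_right)
    moreover have "norm (h X) \<le> \<bar>Bh\<bar> * r ^ (p - 1)"
      using Bh[OF X(1)] mult_left_mono[OF r1, of "\<bar>Bh\<bar>"] by auto
    ultimately show ?thesis unfolding f_def Cf_def
      using norm_triangle_ineq4[of "h X" "of_nat p * (\<Sum>\<nu>=1..p-1. c \<nu> * X ^ (p - 1 - \<nu>))"]
      by (simp add: algebra_simps)
  qed
  have "\<exists>l. ((\<lambda>t. F0 (of_real t)) \<longlongrightarrow> l) at_top"
  proof (rule axis_limit[where K = 0 and C = Cf and f = f, OF _ R0(1) Cf0 \<alpha> \<beta>])
    fix \<rho> \<theta> :: real assume a: "R0 \<le> \<rho>" "\<alpha> < \<theta>" "\<theta> < \<beta>"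
    show "(F0 has_field_derivative exp (- (rcis \<rho> \<theta> ^ p)) * f (rcis \<rho> \<theta>)) (at (rcis \<rho> \<theta>))"
      by (rule F0[OF rV[OF a]])
    show "norm (f (rcis \<rho> \<theta>)) \<le> Cf * \<rho> ^ (p - 1) / \<rho> ^ 0"
      using f_bound[OF rV[OF a], of \<rho>] a R0 by simp
  qed (use p in simp)
  then obtain l where l: "((\<lambda>t. F0 (of_real t)) \<longlongrightarrow> l) at_top" by blast
  \<comment> \<open>The primitive that vanishes at infinity along the positive axis; any other one leads to exponential growth.\<close>
  define F where "F X = F0 X - l" for X
  have F: "(F has_field_derivative exp (- (X ^ p)) * f X) (at X)" if "X \<in> V" for X
    unfolding F_def using F0[OF that] by (auto intro!: derivative_eq_intros)
  have Flim: "((\<lambda>t. F (of_real t)) \<longlongrightarrow> 0) at_top"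
    using tendsto_diff[OF l tendsto_const[of l]] by (simp add: F_def)
  define g where "g X = exp (X ^ p) * F X" for X
  have g': "(g has_field_derivative of_nat p * X ^ (p - 1) * g X + f X) (at X)" if "X \<in> V" for X
    unfolding g_def by (rule derivative_eq_intros F[OF that] refl)+ (simp add: algebra_simps flip: exp_add)

  \<comment> \<open>Expansion of \<open>X\<^sup>1\<^sup>-\<^sup>p f\<close>.\<close>
  define k where "k m = (if m \<le> p - 1 then - of_nat p * c m else hc (m - (p - 1)))" for m
  define gc where "gc = formal_solution_coeff p k"
  have gc0: "gc 0 = 0" by (simp add: gc_def formal_solution_coeff.simps)
  have gc_c: "gc m = c m" if "m \<in> {1..p-1}" for m
    using that p unfolding gc_def by (subst formal_solution_coeff.simps) (auto simp: k_def)
  have gc_rec: "k m + of_nat p * gc m = (if p \<le> m then - of_nat (m - p) * gc (m - p) else 0)" if "1 \<le> m" for m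
    using that p unfolding gc_def by (subst formal_solution_coeff.simps) (auto simp: field_simps)
  define s where "s N X = (\<Sum>m=1..N. gc m / X ^ m)" for N X
  define fN where "fN n X = (h X - (\<Sum>j=1..n. hc j / X ^ j)) + (\<Sum>m=n..p-1+n. of_nat m * gc m / X ^ Suc m)" for n X

  \<comment> \<open>Subtracting a partial sum of the formal solution leaves an equation of the same form, with a quickly decaying inhomogeneity.\<close>
  have remainder: "((\<lambda>X. g X - s (p - 1 + n) X) has_field_derivative
      of_nat p * X ^ (p - 1) * (g X - s (p - 1 + n) X) + fN n X) (at X)" if X: "X \<in> V" "X \<noteq> 0" for n X
  proof -
    define N where "N = p - 1 + n"
    have ds: "(s N has_field_derivative (\<Sum>m=1..N. - of_nat m * gc m / X ^ Suc m)) (at X)"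
      unfolding s_def
    proof (rule DERIV_sum)
      fix m assume "m \<in> {1..N}"
      then obtain m' where m': "m = Suc m'" by (cases m) auto
      show "((\<lambda>X. gc m / X ^ m) has_field_derivative - of_nat m * gc m / X ^ Suc m) (at X)"
        by (rule derivative_eq_intros refl | use X in simp; fail)+ (use X in \<open>simp add: m' divide_simps, simp add: algebra_simps\<close>)
    qed
    have pow: "X ^ (p - 1) * (a / X ^ m) = (if m \<le> p - 1 then a * X ^ (p - 1 - m) else a / X ^ (m - (p - 1)))" for a m
      using X power_diff[of X m "p - 1"] power_diff[of X "p - 1" m] by (simp del: diff_diff_left)
    have splitN: "{1..N} = {1..p-1} \<union> {p..N}" unfolding N_def using p by auto
    have e1: "X ^ (p - 1) * (\<Sum>m=1..N. k m / X ^ m) =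
       - of_nat p * (\<Sum>\<nu>=1..p-1. c \<nu> * X ^ (p - 1 - \<nu>)) + (\<Sum>j=1..n. hc j / X ^ j)"
    proof -
      have "X ^ (p - 1) * (\<Sum>m=1..N. k m / X ^ m) = (\<Sum>m=1..N. X ^ (p - 1) * (k m / X ^ m))"
        by (rule sum_distrib_left)
      also have "\<dots> = (\<Sum>m=1..p-1. X ^ (p - 1) * (k m / X ^ m)) + (\<Sum>m=p..N. X ^ (p - 1) * (k m / X ^ m))"
        unfolding splitN using p by (subst sum.union_disjoint) auto
      also have "(\<Sum>m=1..p-1. X ^ (p - 1) * (k m / X ^ m)) = - of_nat p * (\<Sum>\<nu>=1..p-1. c \<nu> * X ^ (p - 1 - \<nu>))"
        unfolding sum_distrib_left pow by (rule sum.cong) (auto simp: k_def)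
      also have "(\<Sum>m=p..N. X ^ (p - 1) * (k m / X ^ m)) = (\<Sum>j=1..n. hc j / X ^ j)"
        unfolding pow by (rule sum.reindex_bij_witness[of _ "\<lambda>j. j + (p - 1)" "\<lambda>m. m - (p - 1)"])
           (use p in \<open>auto simp: k_def N_def\<close>)
      finally show ?thesis .
    qed
    \<comment> \<open>By the recursion for the coefficients, these terms cancel most of the derivative of the partial sum.\<close>
    have e2: "X ^ (p - 1) * (\<Sum>m=1..N. (k m + of_nat p * gc m) / X ^ m) = - (\<Sum>i<n. of_nat i * gc i / X ^ Suc i)"
    proof -
      have "X ^ (p - 1) * (\<Sum>m=1..N. (k m + of_nat p * gc m) / X ^ m) = (\<Sum>m=1..N. X ^ (p - 1) * ((k m + of_nat p * gc m) / X ^ m))"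
        by (rule sum_distrib_left)
      also have "\<dots> = (\<Sum>m=1..p-1. X ^ (p - 1) * ((k m + of_nat p * gc m) / X ^ m)) + (\<Sum>m=p..N. X ^ (p - 1) * ((k m + of_nat p * gc m) / X ^ m))"
        unfolding splitN using p by (subst sum.union_disjoint) auto
      also have "(\<Sum>m=1..p-1. X ^ (p - 1) * ((k m + of_nat p * gc m) / X ^ m)) = 0"
        by (rule sum.neutral) (use p gc_rec in auto)
      also have "(\<Sum>m=p..N. X ^ (p - 1) * ((k m + of_nat p * gc m) / X ^ m)) = (\<Sum>i<n. - (of_nat i * gc i / X ^ Suc i))"
      proof (rule sum.reindex_bij_witness[of _ "\<lambda>i. i + p" "\<lambda>m. m - p"])
        fix m assume m: "m \<in> {p..N}"
        then have "m - (p - 1) = Suc (m - p)" "\<not> m \<le> p - 1" "1 \<le> m" using p by auto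
        then show "- (of_nat (m - p) * gc (m - p) / X ^ Suc (m - p)) = X ^ (p - 1) * ((k m + of_nat p * gc m) / X ^ m)"
          unfolding pow using gc_rec[of m] m by (simp del: of_nat_diff)
      qed (use p in \<open>auto simp: N_def\<close>)
      finally show ?thesis by (simp add: sum_negf)
    qed
    have e3: "(\<Sum>m=1..N. of_nat m * gc m / X ^ Suc m) = (\<Sum>i<n. of_nat i * gc i / X ^ Suc i) + (\<Sum>m=n..N. of_nat m * gc m / X ^ Suc m)"
    proof -
      have "(\<Sum>m=1..N. of_nat m * gc m / X ^ Suc m) = (\<Sum>m\<in>{..<n} \<union> {n..N}. of_nat m * gc m / X ^ Suc m)"
        by (rule sum.mono_neutral_left) (auto simp: N_def not_less_eq_eq)
      then show ?thesis by (subst (asm) sum.union_disjoint) auto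
    qed
    have key: "of_nat p * X ^ (p - 1) * g X + f X - (\<Sum>m=1..N. - of_nat m * gc m / X ^ Suc m)
       = of_nat p * X ^ (p - 1) * (g X - s N X) + fN n X"
    proof -
      have a: "X ^ (p - 1) * (\<Sum>m=1..N. (k m + of_nat p * gc m) / X ^ m) =
         X ^ (p - 1) * (\<Sum>m=1..N. k m / X ^ m) + of_nat p * X ^ (p - 1) * s N X"
        by (simp add: s_def add_divide_distrib sum.distrib sum_distrib_left algebra_simps)
      have b: "(\<Sum>m=1..N. - of_nat m * gc m / X ^ Suc m) = - (\<Sum>m=1..N. of_nat m * gc m / X ^ Suc m)"
        by (simp add: sum_negf del: power_Suc)
      have lin: "P * G + (H - Pc) - (- E) = P * (G - S) + ((H - Hc) + Tl)"
        if "- I = (- Pc + Hc) + P * S" "E = I + Tl" for P G H Pc E S Hc Tl I :: complex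
      proof -
        have "P * S = Pc - Hc - I" using that(1) by (simp add: algebra_simps)
        then show ?thesis unfolding right_diff_distrib that(2) by simp
      qed
      show ?thesis
        unfolding b f_def fN_def N_def[symmetric]
        by (rule lin[OF _ e3]) (use a e1 e2 in simp)
    qed
    show ?thesis
      using DERIV_diff[OF g'[OF X(1)] ds] unfolding key unfolding N_def .
  qed

  have fN_bound: "\<exists>C R. \<forall>X\<in>V. R \<le> norm X \<longrightarrow> norm (fN n X) \<le> C / norm X ^ Suc n" for n
  proof -
    obtain C R where C: "\<And>X. X \<in> V \<Longrightarrow> R \<le> norm X \<Longrightarrow> norm (h X - (\<Sum>j=1..n. hc j / X ^ j)) \<le> C / norm X ^ Suc n"
      using hc(1) unfolding poincare_expansion_iff by blast
    define D where "D = (\<Sum>m=n..p-1+n. real m * norm (gc m))"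
    have "norm (fN n X) \<le> (C + D) / norm X ^ Suc n" if X: "X \<in> V" "max R 1 \<le> norm X" for X
    proof -
      have "norm (\<Sum>m=n..p-1+n. of_nat m * gc m / X ^ Suc m) \<le> (\<Sum>m=n..p-1+n. real m * norm (gc m) / norm X ^ Suc n)"
      proof (rule sum_norm_le)
        fix m assume m: "m \<in> {n..p-1+n}"
        have "norm X ^ Suc n \<le> norm X ^ Suc m" using m X by (intro power_increasing) auto
        then show "norm (of_nat m * gc m / X ^ Suc m) \<le> real m * norm (gc m) / norm X ^ Suc n"
          unfolding norm_divide norm_mult norm_power norm_of_nat using X
          by (intro divide_left_mono mult_pos_pos zero_less_power mult_nonneg_nonneg) auto
      qed
      also have "\<dots> = D / norm X ^ Suc n" unfolding D_def by (rule sum_divide_distrib[symmetric])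
      finally show ?thesis unfolding fN_def add_divide_distrib
        using C[of X] X by (intro norm_triangle_le add_mono) auto
    qed
    then show ?thesis by blast
  qed

  have r_bound: "\<exists>C R. \<forall>X\<in>V. R \<le> norm X \<longrightarrow> norm (g X - s (p - 1 + n) X) \<le> C / norm X ^ n" for n
  proof -
    obtain C R where C: "\<And>X. X \<in> V \<Longrightarrow> R \<le> norm X \<Longrightarrow> norm (fN n X) \<le> C / norm X ^ Suc n"
      using fN_bound by blast
    define R' where "R' = max R R0"
    define F1 where "F1 X = exp (- (X ^ p)) * (g X - s (p - 1 + n) X)" for X
    have "\<exists>C' R1. R' \<le> R1 \<and> (\<forall>\<rho> \<theta>. R1 \<le> \<rho> \<longrightarrow> \<alpha> < \<theta> \<longrightarrow> \<theta> < \<beta> \<longrightarrow>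
           norm (exp (rcis \<rho> \<theta> ^ p) * F1 (rcis \<rho> \<theta>)) \<le> C' * \<rho> ^ p / \<rho> ^ (n + p))"
    proof (rule decay_bound[where C = "\<bar>C\<bar>" and f = "fN n", OF _ _ _ \<alpha> \<beta>])
      show "0 < p" "1 \<le> R'" "0 \<le> \<bar>C\<bar>" using p R0 by (auto simp: R'_def)
      fix \<rho> \<theta> :: real assume a: "R' \<le> \<rho>" "\<alpha> < \<theta>" "\<theta> < \<beta>"
      have XV: "rcis \<rho> \<theta> \<in> V" and \<rho>: "1 \<le> \<rho>" "R \<le> \<rho>" using a rV R0 by (auto simp: R'_def)
      have X0: "rcis \<rho> \<theta> \<noteq> 0" using \<rho> by simp
      show "(F1 has_field_derivative exp (- (rcis \<rho> \<theta> ^ p)) * fN n (rcis \<rho> \<theta>)) (at (rcis \<rho> \<theta>))"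
        unfolding F1_def by (rule derivative_eq_intros remainder[OF XV X0] refl)+ (simp add: algebra_simps)
      have "norm (fN n (rcis \<rho> \<theta>)) \<le> C / \<rho> ^ Suc n" using C[OF XV] \<rho> by simp
      also have "\<dots> \<le> \<bar>C\<bar> / \<rho> ^ Suc n" using \<rho> by (intro divide_right_mono) auto
      also have "\<dots> = \<bar>C\<bar> * \<rho> ^ (p - 1) / \<rho> ^ (n + p)"
      proof -
        have "n + p = Suc n + (p - 1)" using p by simp
        then have "\<rho> ^ (n + p) = \<rho> ^ Suc n * \<rho> ^ (p - 1)" by (simp only: power_add)
        then show ?thesis using \<rho> by simp
      qed
      finally show "norm (fN n (rcis \<rho> \<theta>)) \<le> \<bar>C\<bar> * \<rho> ^ (p - 1) / \<rho> ^ (n + p)" .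
    next
      have s0: "((\<lambda>t::real. s (p - 1 + n) (of_real t)) \<longlongrightarrow> 0) at_top"
        unfolding s_def
      proof (rule tendsto_null_sum)
        fix m assume m: "m \<in> {1..p-1+n}"
        have "filterlim (\<lambda>t::real. t ^ m) at_top at_top"
          using m by (intro filterlim_pow_at_top filterlim_ident) auto
        then have "filterlim (\<lambda>t::real. of_real (t ^ m) :: complex) at_infinity at_top"
          by (rule filterlim_compose[OF filterlim_of_real_at_infinity])
        then have "filterlim (\<lambda>t::real. (of_real t :: complex) ^ m) at_infinity at_top" by simp
        then show "((\<lambda>t::real. gc m / of_real t ^ m) \<longlongrightarrow> 0) at_top"
          by (rule tendsto_divide_0[OF tendsto_const])
      qed
      have "((\<lambda>t::real. exp (- (of_real t ^ p)) * s (p - 1 + n) (of_real t)) \<longlongrightarrow> 0) at_top"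
      proof (rule Lim_null_comparison)
        show "eventually (\<lambda>t::real. norm (exp (- (of_real t ^ p)) * s (p - 1 + n) (of_real t)) \<le> norm (s (p - 1 + n) (of_real t))) at_top"
          using eventually_ge_at_top[of 0]
        proof eventually_elim
          case (elim t)
          have "norm (exp (- (of_real t ^ p)) :: complex) \<le> 1" using elim by (simp add: norm_exp_eq_Re flip: of_real_power)
          then show ?case unfolding norm_mult by (rule mult_left_le_one_le[OF norm_ge_zero norm_ge_zero])
        qed
      qed (rule tendsto_norm_zero[OF s0])
      from tendsto_diff[OF Flim this]
      show "((\<lambda>t::real. F1 (of_real t)) \<longlongrightarrow> 0) at_top"
        by (simp add: F1_def g_def right_diff_distrib exp_minus field_simps)
    qed
    then obtain C' R1 where R1: "R' \<le> R1" and C': "\<And>\<rho> \<theta>. R1 \<le> \<rho> \<Longrightarrow> \<alpha> < \<theta> \<Longrightarrow> \<theta> < \<beta> \<Longrightarrow>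
           norm (exp (rcis \<rho> \<theta> ^ p) * F1 (rcis \<rho> \<theta>)) \<le> C' * \<rho> ^ p / \<rho> ^ (n + p)" by blast
    have "norm (g X - s (p - 1 + n) X) \<le> C' / norm X ^ n" if X: "X \<in> V" "R1 \<le> norm X" for X
    proof -
      have big: "\<bar>\<mu>\<bar> \<le> norm X" "0 < norm X" using X R1 R0 by (auto simp: R'_def)
      have "norm (exp (X ^ p) * F1 X) \<le> C' * norm X ^ p / norm X ^ (n + p)"
        using C'[OF X(2) polar_V(1,2)[OF X(1) big(1)]] by (simp add: rcis_cmod_Arg)
      moreover have "exp (X ^ p) * F1 X = g X - s (p - 1 + n) X"
        by (simp add: F1_def exp_minus)
      ultimately show ?thesis using big by (simp add: power_add)
    qed
    then show ?thesis by blast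
  qed
  have expansion: "poincare_expansion V g gc"
    unfolding poincare_expansion_iff
  proof
    fix M
    \<comment> \<open>A longer partial sum makes up for the loss in the remainder estimate; the additional terms are small enough.\<close>
    obtain C R where C: "\<And>X. X \<in> V \<Longrightarrow> R \<le> norm X \<Longrightarrow> norm (g X - s (p - 1 + Suc M) X) \<le> C / norm X ^ Suc M"
      using r_bound by blast
    define D where "D = (\<Sum>m=Suc M..p-1+Suc M. norm (gc m))"
    have "norm (g X - s M X) \<le> (C + D) / norm X ^ Suc M" if X: "X \<in> V" "max R 1 \<le> norm X" for X
    proof -
      have "{1..p-1+Suc M} = {1..M} \<union> {Suc M..p-1+Suc M}" by auto
      then have e: "s (p - 1 + Suc M) X = s M X + (\<Sum>m=Suc M..p-1+Suc M. gc m / X ^ m)"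
        unfolding s_def by (simp only:) (subst sum.union_disjoint; auto)
      have "norm (\<Sum>m=Suc M..p-1+Suc M. gc m / X ^ m) \<le> (\<Sum>m=Suc M..p-1+Suc M. norm (gc m) / norm X ^ Suc M)"
      proof (rule sum_norm_le)
        fix m assume m: "m \<in> {Suc M..p-1+Suc M}"
        have "norm X ^ Suc M \<le> norm X ^ m" using m X by (intro power_increasing) auto
        then show "norm (gc m / X ^ m) \<le> norm (gc m) / norm X ^ Suc M"
          unfolding norm_divide norm_power using X
          by (intro divide_left_mono mult_pos_pos zero_less_power) auto
      qed
      also have "\<dots> = D / norm X ^ Suc M" unfolding D_def by (rule sum_divide_distrib[symmetric])
      finally have "norm ((g X - s (p - 1 + Suc M) X) + (\<Sum>m=Suc M..p-1+Suc M. gc m / X ^ m)) \<le> C / norm X ^ Suc M + D / norm X ^ Suc M"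
        using C[of X] X by (intro norm_triangle_le add_mono) auto
      then show ?thesis unfolding e by (simp add: add_divide_distrib)
    qed
    then show "\<exists>C R. \<forall>X\<in>V. R \<le> norm X \<longrightarrow> norm (g X - (\<Sum>m=1..M. gc m / X ^ m)) \<le> C / norm X ^ Suc M"
      unfolding s_def by blast
  qed

  \<comment> \<open>Far out the expansion gives boundedness; near the origin it is a property of the primitive.\<close>
  have bdd: "bounded (g ` V)"
  proof -
    from expansion[unfolded poincare_expansion_iff, rule_format, of 0] obtain C R
      where C: "\<And>X. X \<in> V \<Longrightarrow> R \<le> norm X \<Longrightarrow> norm (g X) \<le> C / norm X" by auto
    define R1 where "R1 = max R R0"
    have R1: "1 \<le> R1" "R \<le> R1" "\<bar>\<mu>\<bar> < R1" using R0 by (auto simp: R1_def)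
    have outer: "norm (g X) \<le> \<bar>C\<bar>" if "X \<in> V" "R1 \<le> norm X" for X
    proof -
      have "norm (g X) \<le> C / norm X" using C that R1 by auto
      also have "\<dots> \<le> \<bar>C\<bar> / 1" using that R1 by (intro frac_le) auto
      finally show ?thesis by simp
    qed
    have nexp: "norm (exp (X ^ p)) \<le> exp (R1 ^ p)" "norm (exp (- (X ^ p))) \<le> exp (R1 ^ p)" if "norm X \<le> R1" for X :: complex
    proof -
      have "norm (X ^ p) \<le> R1 ^ p" unfolding norm_power using that by (intro power_mono) auto
      then show "norm (exp (X ^ p)) \<le> exp (R1 ^ p)" "norm (exp (- (X ^ p))) \<le> exp (R1 ^ p)"
        using norm_exp[of "X ^ p"] norm_exp[of "- (X ^ p)"] by (auto elim!: order_trans)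
    qed
    have "\<exists>B2. \<forall>X\<in>V. norm X \<le> R1 \<longrightarrow> norm (F X) \<le> B2"
    proof (rule bounded_primitive[OF F R1(3)])
      fix X assume X: "X \<in> V" "norm X \<le> R1"
      show "norm (exp (- (X ^ p)) * f X) \<le> exp (R1 ^ p) * (Cf * R1 ^ (p - 1))"
        unfolding norm_mult using nexp[OF X(2)] f_bound[OF X R1(1)] by (intro mult_mono) auto
    next
      fix X assume X: "X \<in> V" "norm X = R1"
      have "F X = exp (- (X ^ p)) * g X" by (simp add: g_def exp_minus)
      then show "norm (F X) \<le> exp (R1 ^ p) * \<bar>C\<bar>"
        using nexp(2)[of X] outer[of X] X by (simp add: norm_mult mult_mono)
    qed
    then obtain B2 where B2: "\<And>X. X \<in> V \<Longrightarrow> norm X \<le> R1 \<Longrightarrow> norm (F X) \<le> B2" by blast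
    have "norm (g X) \<le> max \<bar>C\<bar> (exp (R1 ^ p) * B2)" if X: "X \<in> V" for X
    proof (cases "norm X \<le> R1")
      case True
      then have "norm (g X) \<le> exp (R1 ^ p) * B2"
        unfolding g_def norm_mult using nexp[OF True] B2[OF X True] by (intro mult_mono) auto
      then show ?thesis by simp
    qed (use outer[OF X] in simp)
    then show ?thesis unfolding bounded_iff by blast
  qed
  have "g holomorphic_on V"
    using g' holomorphic_on_open[OF open_V] by blast
  then have gG: "g \<in> G_space V" unfolding G_space_def using bdd expansion by blast
  have ac: "asymp_coeff V g = gc" by (rule asymp_coeff_eqI[OF filter_V expansion gc0])
  have "of_nat p * (T_op V ^^ (p - 1)) g X + h X = of_nat p * X ^ (p - 1) * g X + f X" for X
  proof -
    have "(\<Sum>\<nu>=1..p-1. gc \<nu> * X ^ (p - 1 - \<nu>)) = (\<Sum>\<nu>=1..p-1. c \<nu> * X ^ (p - 1 - \<nu>))"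
      by (rule sum.cong) (use gc_c in auto)
    then show ?thesis unfolding T_power_eq[OF filter_V gG] ac f_def by (simp add: algebra_simps)
  qed
  then show ?thesis
    using gG ac gc_c g' by (intro bexI[of _ g]) auto
qed

text \<open>\<open>exp(-X\<^sup>p) (g - h)\<close> is constant, and tends to \<open>0\<close> along the positive axis.\<close>

lemma linear_equation_unique:
  assumes g: "\<And>X. X \<in> V \<Longrightarrow> (g has_field_derivative of_nat p * X ^ (p - 1) * g X + f X) (at X)" "bounded (g ` V)"
    and h: "\<And>X. X \<in> V \<Longrightarrow> (h has_field_derivative of_nat p * X ^ (p - 1) * h X + f X) (at X)" "bounded (h ` V)"
    and X: "X \<in> V"
  shows "g X = h X"
proof -
  define d where "d X = exp (- (X ^ p)) * (g X - h X)" for X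
  have "d constant_on V"
  proof (rule has_field_derivative_0_imp_constant_on[OF _ simply_connected_imp_connected[OF simply_connected_V] open_V])
    fix X assume X: "X \<in> V"
    show "(d has_field_derivative 0) (at X)"
      unfolding d_def by (rule derivative_eq_intros g(1)[OF X] h(1)[OF X] refl)+ (simp add: algebra_simps)
  qed
  then obtain c where c: "\<And>X. X \<in> V \<Longrightarrow> d X = c" unfolding constant_on_def by blast
  obtain B B' where B: "\<And>X. X \<in> V \<Longrightarrow> norm (g X) \<le> B" "\<And>X. X \<in> V \<Longrightarrow> norm (h X) \<le> B'"
    using g(2) h(2) unfolding bounded_iff by blast
  have "((\<lambda>t::real. c) \<longlongrightarrow> 0) at_top"
  proof (rule Lim_null_comparison)
    have e1: "norm c \<le> exp (- t) * (B + B')" if t: "max 1 (\<bar>\<mu>\<bar> + 1) \<le> t" for t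
    proof -
      have tV: "of_real t \<in> V" using t by (intro of_real_V) auto
      have "norm (g (of_real t) - h (of_real t)) \<le> B + B'"
        using B[OF tV] norm_triangle_ineq4[of "g (of_real t)" "h (of_real t)"] by linarith
      moreover have "norm (exp (- (of_real t ^ p)) :: complex) \<le> exp (- t)"
      proof -
        have "t ^ 1 \<le> t ^ p" using t p by (intro power_increasing) auto
        moreover have "norm (exp (- (of_real t ^ p) :: complex)) = exp (- (t ^ p))"
          by (simp add: norm_exp_eq_Re flip: of_real_power)
        ultimately show ?thesis by simp
      qed
      ultimately show ?thesis unfolding c[OF tV, symmetric] d_def norm_mult
        by (intro mult_mono) auto
    qed
    show "eventually (\<lambda>t::real. norm c \<le> exp (- t) * (B + B')) at_top"
      using eventually_ge_at_top[of "max 1 (\<bar>\<mu>\<bar> + 1)"] by eventually_elim (rule e1)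
    have "((\<lambda>t::real. exp (- t) * (B + B')) \<longlongrightarrow> 0 * (B + B')) at_top"
      by (intro tendsto_intros filterlim_compose[OF exp_at_bot] filterlim_uminus_at_bot_at_top)
    then show "((\<lambda>t::real. exp (- t) * (B + B')) \<longlongrightarrow> 0) at_top" by simp
  qed
  then have "c = 0" by (simp add: tendsto_const_iff)
  then show ?thesis using c[OF X] by (simp add: d_def)
qed

end

section \<open>The operator S and Taylor coefficients\<close>

lemma S_op_holomorphic:
  assumes "open D" "0 \<in> D" "a holomorphic_on D"
  shows "(S_op ^^ n) a holomorphic_on D"
proof (induction n)
  case (Suc n)
  have "S_op ((S_op ^^ n) a) = (\<lambda>z. if z = 0 then deriv ((S_op ^^ n) a) 0 else ((S_op ^^ n) a z - (S_op ^^ n) a 0) / (z - 0))"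
    by (auto simp: S_op_def)
  then show ?case using pole_lemma[OF Suc.IH, of 0] assms by (simp add: interior_open)
qed (use assms in simp)

lemma S_power_cong:
  assumes D: "open D" "0 \<in> D" and "\<And>x. x \<in> D \<Longrightarrow> a x = b x"
  shows "x \<in> D \<Longrightarrow> (S_op ^^ n) a x = (S_op ^^ n) b x"
proof (induction n arbitrary: x)
  case (Suc n)
  have "eventually (\<lambda>x. (S_op ^^ n) a x = (S_op ^^ n) b x) (nhds 0)"
    using D Suc.IH unfolding eventually_nhds by blast
  then have "deriv ((S_op ^^ n) a) 0 = deriv ((S_op ^^ n) b) 0" by (rule deriv_cong_ev) simp
  then show ?case using Suc D by (simp add: S_op_def[of "(S_op ^^ n) a"] S_op_def[of "(S_op ^^ n) b"])
qed (use assms in auto)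

lemma taylor_coeff_cong:
  assumes D: "open D" "0 \<in> D" and ab: "\<And>x. x \<in> D \<Longrightarrow> a x = b x"
  shows "taylor_coeff a n = taylor_coeff b n"
proof -
  have "eventually (\<lambda>x. a x = b x) (nhds 0)" using D ab unfolding eventually_nhds by blast
  then show ?thesis unfolding taylor_coeff_def by (simp add: higher_deriv_cong_ev)
qed

lemma S_power_expand: "x ^ k * (S_op ^^ k) b x = b x - (\<Sum>i<k. (S_op ^^ i) b 0 * x ^ i)"
proof (induction k)
  case (Suc k)
  have "x * (S_op ^^ Suc k) b x = (S_op ^^ k) b x - (S_op ^^ k) b 0"
    by (simp add: S_op_def)
  then have "x ^ k * (x * (S_op ^^ Suc k) b x) = x ^ k * ((S_op ^^ k) b x - (S_op ^^ k) b 0)"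
    by (simp only:)
  then have "x ^ Suc k * (S_op ^^ Suc k) b x = x ^ k * (S_op ^^ k) b x - (S_op ^^ k) b 0 * x ^ k"
    by (simp add: algebra_simps)
  then show ?case unfolding Suc.IH by simp
qed simp

lemma S_power_monomial: "(S_op ^^ n) (\<lambda>x. c * x ^ k) = (\<lambda>x. if n \<le> k then c * x ^ (k - n) else 0)"
proof (induction n)
  case (Suc n)
  have d: "deriv (\<lambda>x. c * x ^ m) 0 = (if m = 1 then c else 0)" for m
  proof -
    have "((\<lambda>x. c * x ^ m) has_field_derivative c * (of_nat m * 0 ^ (m - 1))) (at 0)"
      by (auto intro!: derivative_eq_intros)
    from DERIV_imp_deriv[OF this] show ?thesis by (auto simp: power_0_left)
  qed
  have "S_op (\<lambda>x. if n \<le> k then c * x ^ (k - n) else 0) = (\<lambda>x. if Suc n \<le> k then c * x ^ (k - Suc n) else 0)"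
  proof (cases "n \<le> k")
    case True
    then obtain m where m: "k = n + m" using le_Suc_ex by blast
    show ?thesis using d[of m] unfolding m by (cases m) (auto simp: S_op_def fun_eq_iff)
  qed (auto simp: S_op_def)
  then show ?case using Suc.IH by simp
qed simp

lemma taylor_coeff_monomial: "taylor_coeff (\<lambda>x. c * x ^ k) n = (if n = k then c else 0)"
proof -
  have "(\<lambda>x. c * x ^ k) has_fps_expansion fps_const c * fps_X ^ k"
    by (intro fps_expansion_intros)
  from fps_nth_fps_expansion[OF this, of n] show ?thesis
    by (auto simp: taylor_coeff_def)
qed

text \<open>Separates the coefficients \<open>g\<^sub>m\<^sub>,\<^sub>\<nu>\<close> from \<open>a\<^sub>n\<close> in the equation for the holomorphic parts.\<close>

lemma polynomial_plus_high_order_eq_0: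
  assumes D: "open D" "(0::complex) \<in> D"
  shows "A holomorphic_on D \<Longrightarrow> (\<And>x. x \<in> D \<Longrightarrow> (\<Sum>i<q. d i * x ^ i) + x ^ q * A x = 0) \<Longrightarrow>
    (\<forall>i<q. d i = 0) \<and> (\<forall>x\<in>D. A x = 0)"
proof (induction q arbitrary: d)
  case (Suc q)
  let ?B = "\<lambda>x. (\<Sum>i<q. d (Suc i) * x ^ i) + x ^ q * A x"
  have split: "(\<Sum>i<Suc q. d i * x ^ i) + x ^ Suc q * A x = d 0 + x * ?B x" for x
    by (simp add: sum.lessThan_Suc_shift sum_distrib_left algebra_simps del: sum.lessThan_Suc)
  have d0: "d 0 = 0" using Suc.prems(2)[OF D(2)] unfolding split by simp
  have B: "?B x = 0" if "x \<in> D" "x \<noteq> 0" for x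
    using Suc.prems(2)[OF that(1)] that(2) unfolding split d0 by simp
  have "?B holomorphic_on D" by (intro holomorphic_intros Suc.prems)
  then have "isCont ?B 0" using D holomorphic_on_imp_continuous_on continuous_on_eq_continuous_at by blast
  then have lim: "(?B \<longlongrightarrow> ?B 0) (at 0)" by (simp only: isCont_def)
  have "eventually (\<lambda>x. x \<in> D \<and> x \<noteq> 0) (at 0)"
    using eventually_at_in_open'[OF D] eventually_neq_at_within by eventually_elim auto
  then have "eventually (\<lambda>x. ?B x = 0) (at 0)" by eventually_elim (use B in blast)
  then have "(?B \<longlongrightarrow> 0) (at 0)" by (rule tendsto_eventually)
  then have "?B 0 = 0" using lim tendsto_unique trivial_limit_at by blast
  then have "\<And>x. x \<in> D \<Longrightarrow> ?B x = 0" using B by blast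
  from Suc.IH[OF Suc.prems(1) this] show ?case using d0 by (auto simp: less_Suc_eq_0_disj)
qed simp

section \<open>Coefficients of the expansion in y\<close>

text \<open>Near \<open>(x0, 0)\<close> the double series may be summed over the powers of \<open>x - x0\<close> first; the inner sums are
  power series in \<open>x - x0\<close>, and are the Taylor coefficients with respect to \<open>y\<close>.\<close>

lemma y_coeff_holomorphic:
  assumes "analytic2_on (Pk k) (D1 \<times> D2)" "0 \<in> D2"
  shows "y_coeff Pk j k holomorphic_on D1"
proof -
  have "\<exists>e>0. y_coeff Pk j k holomorphic_on ball x0 e" if x0: "x0 \<in> D1" for x0
  proof -
    obtain r and c :: "nat \<Rightarrow> nat \<Rightarrow> complex" where r: "r > 0" and c: "\<And>x y. x \<in> ball x0 r \<Longrightarrow> y \<in> ball 0 r \<Longrightarrow>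
      ((\<lambda>(i, j). c i j * (x - x0) ^ i * (y - 0) ^ j) has_sum Pk k x y) UNIV"
      using assms x0 unfolding analytic2_on_def by blast
    have sm: "(\<lambda>i. c i j * (x - x0) ^ i * y ^ j) summable_on UNIV" if "x \<in> ball x0 r" "y \<in> ball 0 r" for x y j
    proof -
      have "(\<lambda>(i, j). c i j * (x - x0) ^ i * y ^ j) summable_on UNIV \<times> UNIV"
        using has_sum_imp_summable[OF c[OF that]] by simp
      then have "(\<lambda>(j, i). c i j * (x - x0) ^ i * y ^ j) summable_on UNIV \<times> UNIV"
        by (subst (asm) summable_on_swap) (simp add: case_prod_unfold)
      from summable_on_SigmaD1[OF this, of j] show ?thesis by simp
    qed
    define d where "d j x = (\<Sum>\<^sub>\<infinity>i. c i j * (x - x0) ^ i)" for j x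
    have d: "((\<lambda>i. c i j * (x - x0) ^ i) has_sum d j x) UNIV" if x: "x \<in> ball x0 r" for x j
    proof -
      have "(\<lambda>i. c i j * (x - x0) ^ i * (of_real (r / 2)) ^ j) summable_on UNIV"
        using sm[OF x, of "of_real (r / 2)"] r by (auto simp: norm_of_real simp del: of_real_divide)
      then have "(\<lambda>i. c i j * (x - x0) ^ i * (of_real (r / 2)) ^ j * inverse (of_real (r / 2) ^ j)) summable_on UNIV"
        by (rule summable_on_cmult_left)
      then have "(\<lambda>i. c i j * (x - x0) ^ i) summable_on UNIV" using r by (simp add: field_simps)
      then show ?thesis unfolding d_def by simp
    qed
    have eq: "y_coeff Pk j k x = d j x" if x: "x \<in> ball x0 r" for x
    proof -
      have "(\<lambda>n. d n x * y ^ n) sums Pk k x y" if y: "y \<in> ball 0 r" for y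
      proof -
        have "((\<lambda>(i, j). c i j * (x - x0) ^ i * y ^ j) has_sum Pk k x y) (UNIV \<times> UNIV)"
          using c[OF x y] by simp
        then have "((\<lambda>(j, i). c i j * (x - x0) ^ i * y ^ j) has_sum Pk k x y) (UNIV \<times> UNIV)"
          by (subst (asm) has_sum_swap) (simp add: case_prod_unfold)
        moreover have "((\<lambda>i. (\<lambda>(j, i). c i j * (x - x0) ^ i * y ^ j) (n, i)) has_sum d n x * y ^ n) UNIV" for n
          using has_sum_cmult_left[OF d[OF x, of n], of "y ^ n"] by simp
        ultimately have "((\<lambda>n. d n x * y ^ n) has_sum Pk k x y) UNIV"
          by (rule has_sum_SigmaD)
        then show ?thesis by (rule has_sum_imp_sums)
      qed
      then have "eventually (\<lambda>y. (\<lambda>n. fps_nth (Abs_fps (\<lambda>n. d n x)) n * y ^ n) sums Pk k x y) (nhds 0)"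
        using r unfolding eventually_nhds by (intro exI[of _ "ball 0 r"]) auto
      then have "Pk k x has_fps_expansion Abs_fps (\<lambda>n. d n x)" by (rule has_fps_expansionI)
      from fps_nth_fps_expansion[OF this, of j] show ?thesis by (simp add: y_coeff_def taylor_coeff_def)
    qed
    have "d j holomorphic_on ball x0 r"
      by (rule power_series_holomorphic, rule has_sum_imp_sums, rule d)
    then have "y_coeff Pk j k holomorphic_on ball x0 r"
      by (rule holomorphic_transform) (simp add: eq)
    then show ?thesis using r by blast
  qed
  then have "y_coeff Pk j k field_differentiable at x" if "x \<in> D1" for x
    using that by (meson centre_in_ball holomorphic_on_imp_differentiable_at open_ball)
  then show ?thesis unfolding holomorphic_on_def using field_differentiable_at_within by blast
qed

section \<open>Formal combined series\<close>

context
  fixes D V :: "complex set"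
  assumes D: "open D" "0 \<in> D" and V: "inf at_infinity (principal V) \<noteq> bot"
begin

definition pair_space :: "coeff_pair set" where
  "pair_space = {u. fst u holomorphic_on D \<and> snd u \<in> G_space V}"

lemma combined_space_iff: "u \<in> combined_space D V \<longleftrightarrow> (\<forall>n. u n \<in> pair_space)"
  by (simp add: combined_space_def pair_space_def)

lemma pair_eq_refl [simp]: "pair_eq D V u u"
  by (simp add: pair_eq_def)

lemma pair_mult_cong:
  assumes u: "pair_eq D V u u'" and v: "pair_eq D V v v'"
  shows "pair_eq D V (pair_mult V u v n) (pair_mult V u' v' n)"
proof -
  obtain a g b h a' g' b' h' where [simp]: "u = (a, g)" "v = (b, h)" "u' = (a', g')" "v' = (b', h')" by fastforce
  have e: "\<And>x. x \<in> D \<Longrightarrow> a x = a' x" "\<And>x. x \<in> D \<Longrightarrow> b x = b' x" "\<And>X. X \<in> V \<Longrightarrow> g X = g' X" "\<And>X. X \<in> V \<Longrightarrow> h X = h' X"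
    using u v by (auto simp: pair_eq_def)
  have "asymp_coeff V g = asymp_coeff V g'" "asymp_coeff V h = asymp_coeff V h'"
    by (intro asymp_coeff_cong e; assumption)+
  moreover have "taylor_coeff a n = taylor_coeff a' n" "taylor_coeff b n = taylor_coeff b' n"
    by (intro taylor_coeff_cong[OF D] e; assumption)+
  moreover have "x \<in> D \<Longrightarrow> (S_op ^^ n) a x = (S_op ^^ n) a' x" "x \<in> D \<Longrightarrow> (S_op ^^ n) b x = (S_op ^^ n) b' x" for x
    by (intro S_power_cong[OF D] e; assumption)+
  moreover have "X \<in> V \<Longrightarrow> (T_op V ^^ n) g X = (T_op V ^^ n) g' X" "X \<in> V \<Longrightarrow> (T_op V ^^ n) h X = (T_op V ^^ n) h' X" for X
    by (intro T_power_cong e; assumption)+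
  ultimately show ?thesis using e by (simp add: pair_eq_def pair_mult_def)
qed

lemma pair_mult_0:
  shows "pair_mult V (\<lambda>x. 0, \<lambda>X. 0) v n = (\<lambda>x. 0, \<lambda>X. 0)" "pair_mult V u (\<lambda>x. 0, \<lambda>X. 0) n = (\<lambda>x. 0, \<lambda>X. 0)"
proof -
  have S: "(S_op ^^ n) (\<lambda>x. 0) = (\<lambda>x. 0)" using S_power_monomial[of n 0 0] by (auto simp: fun_eq_iff)
  have t: "taylor_coeff (\<lambda>x. 0) n = 0" using taylor_coeff_monomial[of 0 0 n] by simp
  show "pair_mult V (\<lambda>x. 0, \<lambda>X. 0) v n = (\<lambda>x. 0, \<lambda>X. 0)" "pair_mult V u (\<lambda>x. 0, \<lambda>X. 0) n = (\<lambda>x. 0, \<lambda>X. 0)"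
    by (auto simp: pair_mult_def S t T_power_0[OF V] split: prod.splits)
qed

lemma pair_mult_eq_0:
  "pair_eq D V u (\<lambda>x. 0, \<lambda>X. 0) \<Longrightarrow> pair_eq D V (pair_mult V u v n) (\<lambda>x. 0, \<lambda>X. 0)"
  "pair_eq D V v (\<lambda>x. 0, \<lambda>X. 0) \<Longrightarrow> pair_eq D V (pair_mult V u v n) (\<lambda>x. 0, \<lambda>X. 0)"
  using pair_mult_cong[of u "(\<lambda>x. 0, \<lambda>X. 0)" v v n] pair_mult_cong[of u u v "(\<lambda>x. 0, \<lambda>X. 0)" n]
  by (simp_all add: pair_mult_0)

lemma pair_mult_space:
  assumes "u \<in> pair_space" "v \<in> pair_space"
  shows "pair_mult V u v n \<in> pair_space"
proof -
  obtain a g b h where [simp]: "u = (a, g)" "v = (b, h)" by fastforce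
  have ab: "a holomorphic_on D" "b holomorphic_on D" and gh: "g \<in> G_space V" "h \<in> G_space V"
    using assms by (auto simp: pair_space_def)
  have 1: "(\<lambda>X. if n = 0 then g X * h X else 0) \<in> G_space V"
    using G_space_mult[OF V gh] G_space_0 by (cases "n = 0") simp_all
  have 2: "(\<lambda>x. if n = 0 then a x * b x else 0) holomorphic_on D"
    using ab by (cases "n = 0") (auto intro!: holomorphic_intros)
  show ?thesis
    unfolding pair_space_def pair_mult_def
    using G_space_add[OF G_space_add[OF 1 G_space_cmult[OF G_space_T_power(1)[OF V gh(2)]]] G_space_cmult[OF G_space_T_power(1)[OF V gh(1)]]]
    by (auto intro!: holomorphic_on_add holomorphic_on_mult holomorphic_on_const S_op_holomorphic[OF D] ab 2)
qed

lemma combined_mult_cong: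
  assumes "\<And>i. i \<le> n \<Longrightarrow> pair_eq D V (u i) (u' i)" "\<And>i. i \<le> n \<Longrightarrow> pair_eq D V (v i) (v' i)"
  shows "pair_eq D V (combined_mult V u v n) (combined_mult V u' v' n)"
proof -
  have "pair_eq D V (pair_mult V (u i) (v j) (n - i - j)) (pair_mult V (u' i) (v' j) (n - i - j))" if "i \<le> n" "j \<le> n - i" for i j
    using that assms by (intro pair_mult_cong) auto
  then show ?thesis unfolding pair_eq_def combined_mult_def by (auto intro!: sum.cong)
qed

lemma combined_mult_space:
  assumes "u \<in> combined_space D V" "v \<in> combined_space D V"
  shows "combined_mult V u v \<in> combined_space D V"
proof -
  have "pair_mult V (u i) (v j) m \<in> pair_space" for i j m
    using assms by (intro pair_mult_space) (auto simp: combined_space_iff)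
  then show ?thesis unfolding combined_space_def combined_mult_def pair_space_def
    by (auto intro!: holomorphic_on_sum G_space_sum)
qed

lemma of_holo_space: "a holomorphic_on D \<Longrightarrow> of_holo a \<in> combined_space D V"
  by (auto simp: combined_space_def of_holo_def G_space_0)

lemma combined_power_space: "u \<in> combined_space D V \<Longrightarrow> combined_power V u j \<in> combined_space D V"
  by (induction j) (auto intro: combined_mult_space of_holo_space)

lemma combined_power_cong:
  assumes "\<And>i. i \<le> n \<Longrightarrow> pair_eq D V (u i) (u' i)"
  shows "i \<le> n \<Longrightarrow> pair_eq D V (combined_power V u j i) (combined_power V u' j i)"
proof (induction j arbitrary: i)
  case (Suc j)
  then show ?case using assms by (auto intro!: combined_mult_cong)
qed simp

lemma combined_power_order:
  assumes "pair_eq D V (u 0) (\<lambda>x. 0, \<lambda>X. 0)"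
  shows "n < j \<Longrightarrow> pair_eq D V (combined_power V u j n) (\<lambda>x. 0, \<lambda>X. 0)"
proof (induction j arbitrary: n)
  case (Suc j)
  have "pair_eq D V (pair_mult V (u i) (combined_power V u j l) (n - i - l)) (\<lambda>x. 0, \<lambda>X. 0)" if "i \<le> n" "l \<le> n - i" for i l
  proof (cases "i = 0")
    case True
    then show ?thesis using assms by (auto intro: pair_mult_eq_0)
  next
    case False
    then show ?thesis using that Suc.prems by (intro pair_mult_eq_0(2) Suc.IH) auto
  qed
  then show ?case unfolding combined_power.simps combined_mult_def pair_eq_def
    by (auto intro!: sum.neutral)
qed simp

lemma combined_sum_cong:
  assumes "\<And>i. i \<in> I \<Longrightarrow> pair_eq D V (f i n) (f' i n)"
  shows "pair_eq D V (combined_sum f I n) (combined_sum f' I n)"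
  using assms unfolding pair_eq_def combined_sum_def by (auto intro!: sum.cong)

definition subst_term :: "nat \<Rightarrow> (nat \<Rightarrow> complex \<Rightarrow> complex \<Rightarrow> complex) \<Rightarrow> combined \<Rightarrow> nat \<times> nat \<Rightarrow> combined" where
  "subst_term p Pk y = (\<lambda>(j, k). eta_shift (p * k) (combined_mult V (of_holo (y_coeff Pk j k)) (combined_power V y j)))"

text \<open>The terms with \<open>j > n\<close> or \<open>k > n\<close> do not contribute to the coefficient of \<open>\<eta>\<^sup>n\<close> if \<open>y\<close> is divisible
  by \<open>\<eta>\<close>. This closed form does not refer to summability, so that it applies to arbitrary sequences of
  pairs.\<close>

definition subst_series :: "nat \<Rightarrow> (nat \<Rightarrow> complex \<Rightarrow> complex \<Rightarrow> complex) \<Rightarrow> combined \<Rightarrow> combined" where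
  "subst_series p Pk y n = combined_sum (subst_term p Pk y) ({..n} \<times> {..n}) n"

text \<open>The causality on which the recursion rests.\<close>

lemma subst_series_cong:
  assumes "\<And>i. i \<le> n \<Longrightarrow> pair_eq D V (y i) (y' i)"
  shows "pair_eq D V (subst_series p Pk y n) (subst_series p Pk y' n)"
  unfolding subst_series_def
proof (rule combined_sum_cong, clarify)
  fix j k
  have "pair_eq D V (combined_mult V (of_holo (y_coeff Pk j k)) (combined_power V y j) (n - p * k))
      (combined_mult V (of_holo (y_coeff Pk j k)) (combined_power V y' j) (n - p * k))"
    using combined_power_cong[OF assms] by (intro combined_mult_cong) auto
  then show "pair_eq D V (subst_term p Pk y (j, k) n) (subst_term p Pk y' (j, k) n)"
    by (simp add: subst_term_def eta_shift_def)
qed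

lemma subst_term_space:
  assumes "y \<in> combined_space D V" and P: "\<And>j k. y_coeff Pk j k holomorphic_on D"
  shows "subst_term p Pk y jk \<in> combined_space D V"
proof -
  obtain j k where [simp]: "jk = (j, k)" by fastforce
  have "combined_mult V (of_holo (y_coeff Pk j k)) (combined_power V y j) \<in> combined_space D V"
    by (intro combined_mult_space of_holo_space P combined_power_space assms)
  then show ?thesis unfolding combined_space_def subst_term_def eta_shift_def
    by (auto simp: G_space_0)
qed

lemma subst_series_space:
  assumes "y \<in> combined_space D V" and P: "\<And>j k. y_coeff Pk j k holomorphic_on D"
  shows "subst_series p Pk y \<in> combined_space D V"
  using subst_term_space[OF assms] unfolding subst_series_def combined_space_def combined_sum_def
  by (auto intro!: holomorphic_on_sum G_space_sum)

lemma is_substitution_iff: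
  assumes y: "y \<in> eta_combined_space D V" and P: "\<And>j k. y_coeff Pk j k holomorphic_on D" and p: "0 < p"
  shows "is_substitution D V p Pk y w \<longleftrightarrow> w \<in> combined_space D V \<and> combined_eq D V w (subst_series p Pk y)"
proof -
  have y0: "pair_eq D V (y 0) (\<lambda>x. 0, \<lambda>X. 0)" using y by (simp add: eta_combined_space_def)
  have vanish: "pair_eq D V (subst_term p Pk y (j, k) n) (\<lambda>x. 0, \<lambda>X. 0)" if "n < j \<or> n < k" for j k n
  proof (cases "n < p * k")
    case False
    have "k \<le> p * k" using p by simp
    then have j: "n < j" using that False by linarith
    have "pair_eq D V (pair_mult V (of_holo (y_coeff Pk j k) i) (combined_power V y j l) m) (\<lambda>x. 0, \<lambda>X. 0)" if "l \<le> n" for i l m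
      using that j by (intro pair_mult_eq_0(2) combined_power_order[where u = y, OF y0]) auto
    then show ?thesis
      using False unfolding subst_term_def eta_shift_def combined_mult_def pair_eq_def
      by (auto intro!: sum.neutral)
  qed (simp add: subst_term_def eta_shift_def)
  have ev: "\<forall>\<^sub>F F in finite_subsets_at_top UNIV. pair_eq D V (combined_sum (subst_term p Pk y) F n) (subst_series p Pk y n)" for n
    unfolding eventually_finite_subsets_at_top
  proof (intro exI conjI allI impI)
    fix F assume F: "finite F \<and> {..n} \<times> {..n} \<subseteq> F \<and> F \<subseteq> UNIV"
    have z: "pair_eq D V (subst_term p Pk y jk n) (\<lambda>x. 0, \<lambda>X. 0)" if "jk \<in> F - {..n} \<times> {..n}" for jk
      using that vanish[of n "fst jk" "snd jk"] by (cases jk) auto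
    then show "pair_eq D V (combined_sum (subst_term p Pk y) F n) (subst_series p Pk y n)"
      unfolding pair_eq_def combined_sum_def subst_series_def
      using F by (auto intro!: sum.mono_neutral_right)
  qed auto
  have "eta_adic_sum D V (subst_term p Pk y) UNIV w \<longleftrightarrow> combined_eq D V w (subst_series p Pk y)"
  proof
    assume a: "eta_adic_sum D V (subst_term p Pk y) UNIV w"
    show "combined_eq D V w (subst_series p Pk y)"
      unfolding combined_eq_def
    proof
      fix n
      have "\<forall>\<^sub>F F :: (nat \<times> nat) set in finite_subsets_at_top UNIV. pair_eq D V (w n) (subst_series p Pk y n)"
        using a[unfolded eta_adic_sum_def, rule_format, of n] ev[of n]
        by eventually_elim (simp add: pair_eq_def)
      then show "pair_eq D V (w n) (subst_series p Pk y n)" by simp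
    qed
  next
    assume a: "combined_eq D V w (subst_series p Pk y)"
    show "eta_adic_sum D V (subst_term p Pk y) UNIV w"
      unfolding eta_adic_sum_def
    proof
      fix n
      show "\<forall>\<^sub>F F in finite_subsets_at_top UNIV. pair_eq D V (combined_sum (subst_term p Pk y) F n) (w n)"
        using ev[of n] by eventually_elim (use a in \<open>simp add: pair_eq_def combined_eq_def\<close>)
    qed
  qed
  then show ?thesis unfolding is_substitution_def subst_term_def by simp
qed

lemma of_holo_mult:
  "combined_mult V (of_holo b) y n =
    (\<lambda>x. b x * fst (y n) x + (\<Sum>\<nu>\<le>n. asymp_coeff V (snd (y (n - \<nu>))) \<nu> * (S_op ^^ \<nu>) b x),
     \<lambda>X. \<Sum>\<nu>\<le>n. taylor_coeff b \<nu> * (T_op V ^^ \<nu>) (snd (y (n - \<nu>))) X)"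
proof -
  have z: "pair_mult V (of_holo b i) v m = (\<lambda>x. 0, \<lambda>X. 0)" if "i \<noteq> 0" for i v m
    using that by (simp add: of_holo_def pair_mult_0)
  have 1: "pair_mult V (of_holo b 0) v m =
     (\<lambda>x. (if m = 0 then b x * fst v x else 0) + asymp_coeff V (snd v) m * (S_op ^^ m) b x,
      \<lambda>X. taylor_coeff b m * (T_op V ^^ m) (snd v) X)" for v m
    by (auto simp: of_holo_def pair_mult_def T_power_0[OF V] split: prod.splits)
  have fs: "(\<Sum>i\<le>n. \<Sum>j\<le>n - i. fst (pair_mult V (of_holo b i) (y j) (n - i - j)) x) =
      (\<Sum>j\<le>n. fst (pair_mult V (of_holo b 0) (y j) (n - j)) x)" for x
  proof -
    have "(\<Sum>i\<le>n. \<Sum>j\<le>n - i. fst (pair_mult V (of_holo b i) (y j) (n - i - j)) x) =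
      (\<Sum>i\<in>{0}. \<Sum>j\<le>n - i. fst (pair_mult V (of_holo b i) (y j) (n - i - j)) x)"
      by (rule sum.mono_neutral_right) (auto simp: z)
    then show ?thesis by simp
  qed
  have ss: "(\<Sum>i\<le>n. \<Sum>j\<le>n - i. snd (pair_mult V (of_holo b i) (y j) (n - i - j)) x) =
      (\<Sum>j\<le>n. snd (pair_mult V (of_holo b 0) (y j) (n - j)) x)" for x
  proof -
    have "(\<Sum>i\<le>n. \<Sum>j\<le>n - i. snd (pair_mult V (of_holo b i) (y j) (n - i - j)) x) =
      (\<Sum>i\<in>{0}. \<Sum>j\<le>n - i. snd (pair_mult V (of_holo b i) (y j) (n - i - j)) x)"
      by (rule sum.mono_neutral_right) (auto simp: z)
    then show ?thesis by simp
  qed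
  have rev: "(\<Sum>j\<le>n. t j (n - j)) = (\<Sum>\<nu>\<le>n. t (n - \<nu>) \<nu>)" for t :: "nat \<Rightarrow> nat \<Rightarrow> complex"
    by (rule sum.reindex_bij_witness[of _ "\<lambda>\<nu>. n - \<nu>" "\<lambda>\<nu>. n - \<nu>"]) auto
  have first: "(\<Sum>\<nu>\<le>n. if \<nu> = 0 then b x * fst (y (n - \<nu>)) x else 0) = b x * fst (y n) x" for x
    by (subst sum.delta) auto
  have r1: "(\<Sum>j\<le>n. fst (pair_mult V (of_holo b 0) (y j) (n - j)) x) = (\<Sum>\<nu>\<le>n. fst (pair_mult V (of_holo b 0) (y (n - \<nu>)) \<nu>) x)" for x
    by (rule rev)
  have r2: "(\<Sum>j\<le>n. snd (pair_mult V (of_holo b 0) (y j) (n - j)) x) = (\<Sum>\<nu>\<le>n. snd (pair_mult V (of_holo b 0) (y (n - \<nu>)) \<nu>) x)" for x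
    by (rule rev)
  show ?thesis
    unfolding combined_mult_def fs ss unfolding r1 r2 unfolding 1 by (simp add: sum.distrib first)
qed

end

section \<open>The recursion for the coefficients\<close>

context
  fixes p :: nat and D V :: "complex set" and Pk :: "nat \<Rightarrow> complex \<Rightarrow> complex \<Rightarrow> complex"
  assumes p: "2 \<le> p" and D: "open D" "0 \<in> D" and V: "inf at_infinity (principal V) \<noteq> bot"
    and P: "\<And>j k. y_coeff Pk j k holomorphic_on D"
begin

definition holo_equation :: "combined \<Rightarrow> nat \<Rightarrow> bool" where
  "holo_equation y n \<longleftrightarrow> (\<forall>x\<in>D. (if n < p then 0 else deriv (fst (y (n - p))) x - fst (subst_series V p Pk y (n - p)) x) =
     of_nat p * x ^ (p - 1) * fst (y n) x
       + of_nat p * (\<Sum>\<nu>=1..min n (p - 1). asymp_coeff V (snd (y (n - \<nu>))) \<nu> * x ^ (p - 1 - \<nu>)))"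

definition decay_equation :: "combined \<Rightarrow> nat \<Rightarrow> bool" where
  "decay_equation y n \<longleftrightarrow> (\<forall>X\<in>V. deriv (snd (y n)) X =
     of_nat p * (T_op V ^^ (p - 1)) (snd (y n)) X + (if n = 0 then 0 else snd (subst_series V p Pk y (n - 1)) X))"

text \<open>The factor \<open>p x\<^sup>p\<^sup>-\<^sup>1\<close> has the single Taylor coefficient of index \<open>p - 1\<close>, and \<open>S\<^sup>\<nu>\<close> annihilates it for
  \<open>\<nu> \<ge> p\<close>. The coefficient of \<open>\<eta>\<^sup>n\<close> yields the equation for \<open>a\<^sub>n\<close>, and the one for \<open>g\<^sub>m\<close> with
  \<open>m = n - p + 1\<close>; since \<open>\<epsilon> d/dx\<close> raises the order of \<open>g(x/\<eta>)\<close> by \<open>p - 1\<close> only, the two indices differ.\<close>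

lemma solution_iff:
  assumes y: "y \<in> eta_combined_space D V"
  shows "formal_combined_solution D V p Pk y \<longleftrightarrow> (\<forall>n. holo_equation y n \<and> decay_equation y n)"
proof -
  have yc: "y \<in> combined_space D V" using y by (simp add: eta_combined_space_def)
  have yG: "snd (y n) \<in> G_space V" for n using yc by (simp add: combined_space_def)
  let ?b = "\<lambda>x::complex. of_nat p * x ^ (p - 1)"
  let ?s = "subst_series V p Pk y"
  have mult_fst: "fst (combined_mult V (of_holo ?b) y n) x = of_nat p * x ^ (p - 1) * fst (y n) x
       + of_nat p * (\<Sum>\<nu>=1..min n (p - 1). asymp_coeff V (snd (y (n - \<nu>))) \<nu> * x ^ (p - 1 - \<nu>))" for n x
  proof -
    have "(\<Sum>\<nu>\<le>n. asymp_coeff V (snd (y (n - \<nu>))) \<nu> * (S_op ^^ \<nu>) ?b x) =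
       (\<Sum>\<nu>=1..min n (p - 1). asymp_coeff V (snd (y (n - \<nu>))) \<nu> * (S_op ^^ \<nu>) ?b x)"
    proof (rule sum.mono_neutral_right)
      show "\<forall>\<nu>\<in>{..n} - {1..min n (p - 1)}. asymp_coeff V (snd (y (n - \<nu>))) \<nu> * (S_op ^^ \<nu>) ?b x = 0"
      proof
        fix \<nu> assume "\<nu> \<in> {..n} - {1..min n (p - 1)}"
        then have "\<nu> = 0 \<or> p - 1 < \<nu>" by auto
        then show "asymp_coeff V (snd (y (n - \<nu>))) \<nu> * (S_op ^^ \<nu>) ?b x = 0"
          using asymp_coeff_expansion(2)[OF V yG, of n] by (auto simp: S_power_monomial)
      qed
    qed auto
    also have "\<dots> = of_nat p * (\<Sum>\<nu>=1..min n (p - 1). asymp_coeff V (snd (y (n - \<nu>))) \<nu> * x ^ (p - 1 - \<nu>))"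
      unfolding sum_distrib_left by (rule sum.cong) (auto simp: S_power_monomial)
    finally show ?thesis unfolding of_holo_mult[OF D V] by simp
  qed
  have mult_snd: "snd (combined_mult V (of_holo ?b) y n) X =
     (if n < p - 1 then 0 else of_nat p * (T_op V ^^ (p - 1)) (snd (y (n - (p - 1)))) X)" for n X
  proof -
    have "(\<Sum>\<nu>\<le>n. taylor_coeff ?b \<nu> * (T_op V ^^ \<nu>) (snd (y (n - \<nu>))) X) =
       (\<Sum>\<nu>\<le>n. if \<nu> = p - 1 then of_nat p * (T_op V ^^ (p - 1)) (snd (y (n - (p - 1)))) X else 0)"
      by (rule sum.cong) (auto simp: taylor_coeff_monomial)
    then show ?thesis unfolding of_holo_mult[OF D V] by auto
  qed
  have coeff: "pair_eq D V (eta_shift (p - 1) (eta_deriv y) n)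
      (combined_add (combined_mult V (of_holo ?b) y) (eta_shift p w) n) \<longleftrightarrow>
      holo_equation y n \<and> (p - 1 \<le> n \<longrightarrow> decay_equation y (n - (p - 1)))"
    if w: "combined_eq D V w ?s" for w n
  proof -
    have w': "\<And>k x. x \<in> D \<Longrightarrow> fst (w k) x = fst (?s k) x" "\<And>k X. X \<in> V \<Longrightarrow> snd (w k) X = snd (?s k) X"
      using w by (auto simp: combined_eq_def pair_eq_def)
    consider "n < p - 1" | "n = p - 1" | "p \<le> n" by linarith
    then show ?thesis
    proof cases
      case 1
      then have "n < p" "n < p - 1" by auto
      then show ?thesis
        unfolding pair_eq_def combined_add_def eta_shift_def fst_conv snd_conv mult_fst mult_snd holo_equation_def
        by auto
    next
      case 2
      then have "n < p" "\<not> n < p - 1" "n - (p - 1) = 0" using p by auto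
      then show ?thesis
        unfolding pair_eq_def combined_add_def eta_shift_def eta_deriv_def fst_conv snd_conv mult_fst mult_snd holo_equation_def decay_equation_def
        by auto
    next
      case 3
      then have n: "\<not> n < p" "\<not> n < p - 1" "n - (p - 1) \<noteq> 0" "n - (p - 1) - 1 = n - p" "p - 1 \<le> n" using p by auto
      have "(\<forall>x\<in>D. deriv (fst (y (n - p))) x = A x + fst (w (n - p)) x) \<longleftrightarrow>
            (\<forall>x\<in>D. deriv (fst (y (n - p))) x - fst (?s (n - p)) x = A x)" for A
        using w' by (auto simp: algebra_simps)
      then show ?thesis
        using w' n unfolding pair_eq_def combined_add_def eta_shift_def eta_deriv_def fst_conv snd_conv mult_fst mult_snd holo_equation_def decay_equation_def
        by simp
    qed
  qed
  have all: "combined_eq D V (eta_shift (p - 1) (eta_deriv y)) (combined_add (combined_mult V (of_holo ?b) y) (eta_shift p w))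
      \<longleftrightarrow> (\<forall>n. holo_equation y n \<and> decay_equation y n)" if w: "combined_eq D V w ?s" for w
    unfolding combined_eq_def coeff[OF w] by (metis diff_add_inverse le_add1)
  have s: "?s \<in> combined_space D V" by (rule subst_series_space[OF D V yc P])
  have ss: "combined_eq D V ?s ?s" by (simp add: combined_eq_def pair_eq_def)
  have sub: "is_substitution D V p Pk y w \<longleftrightarrow> w \<in> combined_space D V \<and> combined_eq D V w ?s" for w
    by (rule is_substitution_iff[OF D V y P]) (use p in simp)
  show ?thesis unfolding formal_combined_solution_def sub using all s ss by blast
qed

text \<open>By strong induction. The coefficients \<open>g\<^sub>n\<^sub>,\<^sub>\<nu>\<close> with \<open>1 \<le> \<nu> < p\<close> are read off from the holomorphic
  equation of index \<open>n + \<nu>\<close>, whose left-hand side only involves indices below \<open>n\<close>.\<close>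

lemma combined_eq_of_equations:
  assumes y: "y \<in> eta_combined_space D V" and z: "z \<in> eta_combined_space D V"
    and ey: "\<And>n. holo_equation y n" "\<And>n. decay_equation y n"
    and ez: "\<And>n. holo_equation z n" "\<And>n. decay_equation z n"
    and unique: "\<And>g h f. g \<in> G_space V \<Longrightarrow> h \<in> G_space V \<Longrightarrow>
      (\<And>X. X \<in> V \<Longrightarrow> deriv g X = of_nat p * X ^ (p - 1) * g X + f X) \<Longrightarrow>
      (\<And>X. X \<in> V \<Longrightarrow> deriv h X = of_nat p * X ^ (p - 1) * h X + f X) \<Longrightarrow> \<forall>X\<in>V. g X = h X"
  shows "combined_eq D V z y"
  unfolding combined_eq_def
proof
  have yz: "y \<in> combined_space D V" "z \<in> combined_space D V" using y z by (simp_all add: eta_combined_space_def)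
  then have hol: "\<And>n. fst (y n) holomorphic_on D" "\<And>n. fst (z n) holomorphic_on D"
    and G: "\<And>n. snd (y n) \<in> G_space V" "\<And>n. snd (z n) \<in> G_space V"
    by (auto simp: combined_space_def)
  let ?s = "subst_series V p Pk"
  fix n show "pair_eq D V (z n) (y n)"
  proof (induction n rule: less_induct)
    case (less n)
    have s: "pair_eq D V (?s z k) (?s y k)" if "k < n" for k
      using that less by (intro subst_series_cong[OF D V]) auto
    have d: "deriv (fst (z k)) x = deriv (fst (y k)) x" if "k < n" "x \<in> D" for k x
    proof (rule deriv_cong_ev)
      show "eventually (\<lambda>x. fst (z k) x = fst (y k) x) (nhds x)"
        using less[OF that(1)] D(1) that(2) unfolding eventually_nhds pair_eq_def by blast
    qed simp
    define e where "e N \<nu> = (if \<nu> \<le> N then of_nat p * (asymp_coeff V (snd (z (N - \<nu>))) \<nu> - asymp_coeff V (snd (y (N - \<nu>))) \<nu>) else 0)" for N \<nu>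

    \<comment> \<open>The left-hand sides of the holomorphic equations of index \<open>N\<close> agree by the induction hypothesis, and a polynomial of degree less than \<open>p - 1\<close> is a multiple of \<open>x\<^sup>p\<^sup>-\<^sup>1\<close> only if it vanishes.\<close>
    have key: "(\<forall>\<nu>\<in>{1..p-1}. e N \<nu> = 0) \<and> (\<forall>x\<in>D. fst (z N) x = fst (y N) x)" if N: "N < n + p"
      and N0: "p \<le> N \<Longrightarrow> N - p < n" for N
    proof -
      have eq: "(\<Sum>i<p-1. e N (p - 1 - i) * x ^ i) + x ^ (p - 1) * (of_nat p * (fst (z N) x - fst (y N) x)) = 0" if x: "x \<in> D" for x
      proof -
        have "(\<Sum>i<p-1. e N (p - 1 - i) * x ^ i) = (\<Sum>\<nu>=1..p-1. e N \<nu> * x ^ (p - 1 - \<nu>))"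
          by (rule sum.reindex_bij_witness[of _ "\<lambda>\<nu>. p - 1 - \<nu>" "\<lambda>i. p - 1 - i"]) auto
        also have "\<dots> = (\<Sum>\<nu>=1..min N (p-1). e N \<nu> * x ^ (p - 1 - \<nu>))"
          by (rule sum.mono_neutral_right) (auto simp: e_def)
        also have "\<dots> = of_nat p * (\<Sum>\<nu>=1..min N (p - 1). asymp_coeff V (snd (z (N - \<nu>))) \<nu> * x ^ (p - 1 - \<nu>))
            - of_nat p * (\<Sum>\<nu>=1..min N (p - 1). asymp_coeff V (snd (y (N - \<nu>))) \<nu> * x ^ (p - 1 - \<nu>))"
          unfolding sum_distrib_left sum_subtractf[symmetric] by (rule sum.cong) (auto simp: e_def algebra_simps)
        finally have 1: "(\<Sum>i<p-1. e N (p - 1 - i) * x ^ i) = \<dots>" .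
        have "(if N < p then 0 else deriv (fst (z (N - p))) x - fst (?s z (N - p)) x) =
              (if N < p then 0 else deriv (fst (y (N - p))) x - fst (?s y (N - p)) x)"
          using d[of "N - p" x] s[of "N - p"] x N0 by (auto simp: pair_eq_def)
        then show ?thesis
          using ez(1)[of N, unfolded holo_equation_def, rule_format, OF x]
            ey(1)[of N, unfolded holo_equation_def, rule_format, OF x]
          unfolding 1 by (simp add: algebra_simps)
      qed
      have h: "(\<lambda>x. of_nat p * (fst (z N) x - fst (y N) x)) holomorphic_on D"
        by (intro holomorphic_intros hol)
      from polynomial_plus_high_order_eq_0[OF D h eq]
      have "\<forall>i<p-1. e N (p - 1 - i) = 0" and zy: "\<forall>x\<in>D. fst (z N) x = fst (y N) x" using p by auto
      then have "e N \<nu> = 0" if "\<nu> \<in> {1..p-1}" for \<nu>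
        using that by (metis (no_types, lifting) One_nat_def Suc_le_eq atLeastAtMost_iff diff_diff_cancel diff_less less_le_trans)
      with zy show ?thesis by blast
    qed
    have c: "asymp_coeff V (snd (z n)) \<nu> = asymp_coeff V (snd (y n)) \<nu>" if \<nu>: "\<nu> \<in> {1..p-1}" for \<nu>
    proof -
      have "e (n + \<nu>) \<nu> = 0" using key[of "n + \<nu>"] \<nu> by auto
      then show ?thesis using p by (simp add: e_def)
    qed
    define f where "f X = - of_nat p * (\<Sum>\<nu>=1..p-1. asymp_coeff V (snd (y n)) \<nu> * X ^ (p - 1 - \<nu>))
        + (if n = 0 then 0 else snd (?s y (n - 1)) X)" for X
    have "\<forall>X\<in>V. snd (z n) X = snd (y n) X"
    proof (rule unique[OF G(2) G(1), where f = f])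
      fix X assume X: "X \<in> V"
      show "deriv (snd (y n)) X = of_nat p * X ^ (p - 1) * snd (y n) X + f X"
        using ey(2)[of n, unfolded decay_equation_def, rule_format, OF X]
        unfolding T_power_eq[OF V G(1)] f_def by (simp add: algebra_simps)
      have 1: "(if n = 0 then 0 else snd (?s z (n - 1)) X) = (if n = 0 then 0 else snd (?s y (n - 1)) X)"
        using s[of "n - 1"] X by (auto simp: pair_eq_def)
      have 2: "(\<Sum>\<nu>=1..p-1. asymp_coeff V (snd (z n)) \<nu> * X ^ (p - 1 - \<nu>)) = (\<Sum>\<nu>=1..p-1. asymp_coeff V (snd (y n)) \<nu> * X ^ (p - 1 - \<nu>))"
        by (rule sum.cong) (use c in auto)
      show "deriv (snd (z n)) X = of_nat p * X ^ (p - 1) * snd (z n) X + f X"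
        using ez(2)[of n, unfolded decay_equation_def, rule_format, OF X]
        unfolding T_power_eq[OF V G(2)] f_def 1 2 by (simp add: algebra_simps)
    qed
    moreover have "\<forall>x\<in>D. fst (z n) x = fst (y n) x" using key[of n] p by auto
    ultimately show ?case by (simp add: pair_eq_def)
  qed
qed

text \<open>Replacing the later coefficients by \<open>0\<close> makes the substitution series literally independent of them;
  \<open>subst_series_cong\<close> only gives independence up to \<open>pair_eq\<close>.\<close>

definition truncate :: "combined \<Rightarrow> nat \<Rightarrow> combined" where
  "truncate y n i = (if i < n then y i else (\<lambda>x. 0, \<lambda>X. 0))"

definition rhs_holo :: "combined \<Rightarrow> nat \<Rightarrow> complex \<Rightarrow> complex" where
  "rhs_holo y k x = deriv (fst (y k)) x - fst (subst_series V p Pk (truncate y (Suc k)) k) x"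

text \<open>The step of the recursion: \<open>u\<close> is a valid \<open>n\<close>-th coefficient after the coefficients of \<open>y\<close> below \<open>n\<close>.
  The condition on the asymptotic coefficients makes the later holomorphic equations solvable, and \<open>S\<^sup>p\<^sup>-\<^sup>1\<close>
  removes from their left-hand side exactly the terms that these coefficients account for.\<close>

definition admissible :: "combined \<Rightarrow> nat \<Rightarrow> coeff_pair \<Rightarrow> bool" where
  "admissible y n u \<longleftrightarrow> fst u holomorphic_on D \<and> snd u \<in> G_space V \<and>
     (n = 0 \<longrightarrow> u = (\<lambda>x. 0, \<lambda>X. 0)) \<and>
     fst u = (\<lambda>x. if n < p then 0 else (S_op ^^ (p - 1)) (rhs_holo y (n - p)) x / of_nat p) \<and>
     (\<forall>\<nu>\<in>{1..p-1}. asymp_coeff V (snd u) \<nu> =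
        (if n + \<nu> < p then 0 else (S_op ^^ (p - 1 - \<nu>)) (rhs_holo y (n + \<nu> - p)) 0 / of_nat p)) \<and>
     (\<forall>X\<in>V. deriv (snd u) X = of_nat p * (T_op V ^^ (p - 1)) (snd u) X
        + (if n = 0 then 0 else snd (subst_series V p Pk (truncate y n) (n - 1)) X))"

lemma truncate_space: "(\<And>i. i < n \<Longrightarrow> fst (y i) holomorphic_on D \<and> snd (y i) \<in> G_space V) \<Longrightarrow> truncate y n \<in> combined_space D V"
  by (auto simp: combined_space_def truncate_def G_space_0)

lemma equations_of_admissible:
  assumes y: "\<And>n. admissible y n (y n)"
  shows "y \<in> eta_combined_space D V" "holo_equation y n" "decay_equation y n"
proof -
  have tr: "pair_eq D V (subst_series V p Pk (truncate y (Suc k)) k) (subst_series V p Pk y k)" for k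
    by (rule subst_series_cong[OF D V]) (simp add: truncate_def pair_eq_def)
  have yG: "\<And>n. fst (y n) holomorphic_on D" "\<And>n. snd (y n) \<in> G_space V" "y 0 = (\<lambda>x. 0, \<lambda>X. 0)"
    using y unfolding admissible_def by blast+
  show "y \<in> eta_combined_space D V"
    using yG by (simp add: eta_combined_space_def combined_space_def pair_eq_def)
  show "decay_equation y n"
    unfolding decay_equation_def
  proof
    fix X assume X: "X \<in> V"
    have "deriv (snd (y n)) X = of_nat p * (T_op V ^^ (p - 1)) (snd (y n)) X
        + (if n = 0 then 0 else snd (subst_series V p Pk (truncate y n) (n - 1)) X)"
      using y[of n] X unfolding admissible_def by blast
    then show "deriv (snd (y n)) X = of_nat p * (T_op V ^^ (p - 1)) (snd (y n)) X
        + (if n = 0 then 0 else snd (subst_series V p Pk y (n - 1)) X)"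
      using tr[of "n - 1"] X by (cases n) (auto simp: pair_eq_def)
  qed
  show "holo_equation y n"
    unfolding holo_equation_def
  proof
    fix x assume x: "x \<in> D"
    have a: "fst (y n) x = (if n < p then 0 else (S_op ^^ (p - 1)) (rhs_holo y (n - p)) x / of_nat p)"
      using y[of n] unfolding admissible_def by metis
    have c: "asymp_coeff V (snd (y (n - \<nu>))) \<nu> = (if n < p then 0 else (S_op ^^ (p - 1 - \<nu>)) (rhs_holo y (n - p)) 0 / of_nat p)"
      if "\<nu> \<in> {1..min n (p - 1)}" for \<nu>
    proof -
      have "\<nu> \<in> {1..p-1}" "n - \<nu> + \<nu> = n" using that by auto
      then show ?thesis using y[of "n - \<nu>"] unfolding admissible_def by metis
    qed
    show "(if n < p then 0 else deriv (fst (y (n - p))) x - fst (subst_series V p Pk y (n - p)) x) =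
       of_nat p * x ^ (p - 1) * fst (y n) x
       + of_nat p * (\<Sum>\<nu>=1..min n (p - 1). asymp_coeff V (snd (y (n - \<nu>))) \<nu> * x ^ (p - 1 - \<nu>))"
    proof (cases "n < p")
      case True
      then show ?thesis using a c by simp
    next
      case False
      let ?R = "rhs_holo y (n - p)"
      have "of_nat p * (\<Sum>\<nu>=1..min n (p - 1). asymp_coeff V (snd (y (n - \<nu>))) \<nu> * x ^ (p - 1 - \<nu>)) =
        (\<Sum>\<nu>=1..min n (p - 1). (S_op ^^ (p - 1 - \<nu>)) ?R 0 * x ^ (p - 1 - \<nu>))"
        unfolding sum_distrib_left by (rule sum.cong) (use c False p in auto)
      also have "\<dots> = (\<Sum>i<p-1. (S_op ^^ i) ?R 0 * x ^ i)"
        by (rule sum.reindex_bij_witness[of _ "\<lambda>i. p - 1 - i" "\<lambda>\<nu>. p - 1 - \<nu>"]) (use False in auto)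
      finally have sum: "of_nat p * (\<Sum>\<nu>=1..min n (p - 1). asymp_coeff V (snd (y (n - \<nu>))) \<nu> * x ^ (p - 1 - \<nu>)) =
        (\<Sum>i<p-1. (S_op ^^ i) ?R 0 * x ^ i)" .
      have "of_nat p * x ^ (p - 1) * fst (y n) x = x ^ (p - 1) * (S_op ^^ (p - 1)) ?R x"
        using a False p by simp
      also have "\<dots> = ?R x - (\<Sum>i<p-1. (S_op ^^ i) ?R 0 * x ^ i)" by (rule S_power_expand)
      finally show ?thesis
        using False tr[of "n - p"] x unfolding sum by (simp add: rhs_holo_def pair_eq_def)
    qed
  qed
qed

lemma admissible_exists:
  assumes solve: "\<And>h c. h \<in> G_space V \<Longrightarrow> \<exists>g\<in>G_space V. (\<forall>\<nu>\<in>{1..p-1}. asymp_coeff V g \<nu> = c \<nu>) \<and>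
     (\<forall>X\<in>V. deriv g X = of_nat p * (T_op V ^^ (p - 1)) g X + h X)"
  shows "\<exists>y. \<forall>n. admissible y n (y n)"
proof (rule dependent_wellorder_choice)
  fix u :: coeff_pair and f g :: combined and n :: nat
  assume fg: "\<And>i. i < n \<Longrightarrow> f i = g i"
  have t: "truncate f m = truncate g m" if "m \<le> n" for m using that fg by (auto simp: truncate_def fun_eq_iff)
  have R: "rhs_holo f k = rhs_holo g k" if "k < n" for k
    by (rule ext) (simp add: rhs_holo_def fg[OF that] t[OF Suc_leI[OF that]])
  have R1: "(\<lambda>x. if n < p then 0 else (S_op ^^ (p - 1)) (rhs_holo f (n - p)) x / of_nat p) =
     (\<lambda>x. if n < p then 0 else (S_op ^^ (p - 1)) (rhs_holo g (n - p)) x / of_nat p)"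
    using R[of "n - p"] p by (cases "n < p") auto
  have R2: "(if n + \<nu> < p then 0 else (S_op ^^ (p - 1 - \<nu>)) (rhs_holo f (n + \<nu> - p)) 0 / of_nat p) =
     (if n + \<nu> < p then 0 else (S_op ^^ (p - 1 - \<nu>)) (rhs_holo g (n + \<nu> - p)) 0 / of_nat p)" if "\<nu> \<in> {1..p-1}" for \<nu>
    using R[of "n + \<nu> - p"] that by auto
  show "admissible f n u = admissible g n u"
    unfolding admissible_def R1 t[OF order_refl] using R2 by auto
next
  fix n :: nat and y :: combined
  assume IH: "\<And>i. i < n \<Longrightarrow> admissible y i (y i)"
  then have hol: "\<And>i. i < n \<Longrightarrow> fst (y i) holomorphic_on D \<and> snd (y i) \<in> G_space V"
    unfolding admissible_def by blast
  show "\<exists>u. admissible y n u"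
  proof (cases "n = 0")
    case True
    have "(\<lambda>X. 0) \<in> G_space V" "asymp_coeff V (\<lambda>X. 0) = (\<lambda>m. 0)" "(T_op V ^^ (p - 1)) (\<lambda>X. 0) = (\<lambda>X. 0)"
      by (rule G_space_0 T_power_0[OF V])+
    then have "admissible y n (\<lambda>x. 0, \<lambda>X. 0)"
      using True p unfolding admissible_def by auto
    then show ?thesis by blast
  next
    case False
    define h where "h = snd (subst_series V p Pk (truncate y n) (n - 1))"
    have sp: "subst_series V p Pk (truncate y m) \<in> combined_space D V" if "m \<le> n" for m
      by (intro subst_series_space[OF D V] truncate_space P) (use hol that in auto)
    have h: "h \<in> G_space V" using sp[of n] by (simp add: h_def combined_space_def)
    obtain g where g: "g \<in> G_space V"
      "\<forall>\<nu>\<in>{1..p-1}. asymp_coeff V g \<nu> = (if n + \<nu> < p then 0 else (S_op ^^ (p - 1 - \<nu>)) (rhs_holo y (n + \<nu> - p)) 0 / of_nat p)"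
      "\<forall>X\<in>V. deriv g X = of_nat p * (T_op V ^^ (p - 1)) g X + h X"
      using solve[OF h, of "\<lambda>\<nu>. if n + \<nu> < p then 0 else (S_op ^^ (p - 1 - \<nu>)) (rhs_holo y (n + \<nu> - p)) 0 / of_nat p"] by blast
    define a where "a = (\<lambda>x. if n < p then 0 else (S_op ^^ (p - 1)) (rhs_holo y (n - p)) x / of_nat p)"
    have "a holomorphic_on D"
    proof (cases "n < p")
      case nlt: False
      then have k: "n - p < n" using p by simp
      have "fst (subst_series V p Pk (truncate y (Suc (n - p))) (n - p)) holomorphic_on D"
        using sp[of "Suc (n - p)"] k by (simp add: combined_space_def)
      moreover have "deriv (fst (y (n - p))) holomorphic_on D"
        using hol[OF k] D by (auto intro: holomorphic_deriv)
      ultimately have "rhs_holo y (n - p) holomorphic_on D"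
        unfolding rhs_holo_def by (rule holomorphic_on_diff[rotated])
      from S_op_holomorphic[OF D this, of "p - 1"] show ?thesis
        using nlt p unfolding a_def by (auto intro!: holomorphic_intros)
    qed (simp add: a_def)
    then have "admissible y n (a, g)"
      unfolding admissible_def using g False by (simp add: a_def h_def)
    then show ?thesis by blast
  qed
qed

end

section \<open>The formal combined solution\<close>

theorem mainTheorem2:
  fixes p :: nat and r0 r2 \<epsilon>0 :: real
  assumes "2 \<le> p" and "0 < r0" and "0 < r2" and "0 < \<epsilon>0"
  shows "\<exists>\<delta>0>0. \<forall>\<delta>. 0 < \<delta> \<and> \<delta> < \<delta>0 \<longrightarrow>
    (\<forall>(P :: complex \<Rightarrow> complex \<Rightarrow> complex \<Rightarrow> complex)
       (Pk :: nat \<Rightarrow> complex \<Rightarrow> complex \<Rightarrow> complex) \<alpha> \<beta> \<mu>.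
       let D1 = ball 0 r0; D2 = ball 0 r2; \<Sigma> = sector (- \<delta>) \<delta> \<epsilon>0;
           V = quasi_sector \<alpha> \<beta> \<infinity> \<mu>
       in analytic3_on P (D1 \<times> D2 \<times> \<Sigma>) \<longrightarrow>
          bounded ((\<lambda>(x, y, \<epsilon>). P x y \<epsilon>) ` (D1 \<times> D2 \<times> \<Sigma>)) \<longrightarrow>
          gevrey1_expansion D1 D2 \<Sigma> P Pk \<longrightarrow>
          \<mu> \<noteq> 0 \<longrightarrow>
          - (3 * pi / (2 * real p)) < \<alpha> \<longrightarrow> \<alpha> < 0 \<longrightarrow> 0 < \<beta> \<longrightarrow> \<beta> < 3 * pi / (2 * real p) \<longrightarrow>
          (\<exists>y \<in> eta_combined_space D1 V. formal_combined_solution D1 V p Pk y \<and>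
             (\<forall>z \<in> eta_combined_space D1 V.
                formal_combined_solution D1 V p Pk z \<longrightarrow> combined_eq D1 V z y)))"
proof (intro exI[of _ 1] conjI allI impI, simp, unfold Let_def, intro impI)
  fix \<delta> :: real and P :: "complex \<Rightarrow> complex \<Rightarrow> complex \<Rightarrow> complex"
    and Pk :: "nat \<Rightarrow> complex \<Rightarrow> complex \<Rightarrow> complex" and \<alpha> \<beta> \<mu> :: real
  define D where "D = ball (0::complex) r0"
  define V where "V = quasi_sector \<alpha> \<beta> \<infinity> \<mu>"
  assume gevrey: "gevrey1_expansion (ball 0 r0) (ball 0 r2) (sector (- \<delta>) \<delta> \<epsilon>0) P Pk"
    and \<mu>: "\<mu> \<noteq> 0" and angles: "- (3 * pi / (2 * real p)) < \<alpha>" "\<alpha> < 0" "0 < \<beta>" "\<beta> < 3 * pi / (2 * real p)"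
  note geometry = \<open>2 \<le> p\<close> \<mu> angles V_def
  have D: "open D" "0 \<in> D" using assms by (auto simp: D_def)
  have filter: "inf at_infinity (principal V) \<noteq> bot" by (rule filter_V[OF geometry])
  have "open V" by (rule open_V[OF geometry])
  have P: "y_coeff Pk j k holomorphic_on D" for j k
    using gevrey assms unfolding gevrey1_expansion_def D_def
    by (intro y_coeff_holomorphic[of Pk k "ball 0 r0" "ball 0 r2"]) auto
  have G_deriv: "(g has_field_derivative deriv g X) (at X)" if "g \<in> G_space V" "X \<in> V" for g X
    using that \<open>open V\<close> unfolding G_space_def by (auto intro: holomorphic_derivI)
  have solve: "\<exists>g\<in>G_space V. (\<forall>\<nu>\<in>{1..p-1}. asymp_coeff V g \<nu> = c \<nu>) \<and>
     (\<forall>X\<in>V. deriv g X = of_nat p * (T_op V ^^ (p - 1)) g X + h X)" if "h \<in> G_space V" for h c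
    using linear_equation_exists[OF geometry that, of c] DERIV_imp_deriv by blast
  have unique: "\<forall>X\<in>V. g X = h X" if "g \<in> G_space V" "h \<in> G_space V"
      "\<And>X. X \<in> V \<Longrightarrow> deriv g X = of_nat p * X ^ (p - 1) * g X + f X"
      "\<And>X. X \<in> V \<Longrightarrow> deriv h X = of_nat p * X ^ (p - 1) * h X + f X" for g h f
  proof
    fix X assume "X \<in> V"
    moreover have "bounded (g ` V)" "bounded (h ` V)" using that by (auto simp: G_space_def)
    ultimately show "g X = h X"
      using linear_equation_unique[OF geometry, of g f h X] G_deriv[OF that(1)] G_deriv[OF that(2)] that(3,4) by metis
  qed
  note recursion = \<open>2 \<le> p\<close> D filter P
  obtain y where y: "\<And>n. admissible p D V Pk y n (y n)"
    using admissible_exists[OF recursion solve] by blast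
  note eqs = equations_of_admissible[OF recursion y]
  have "formal_combined_solution D V p Pk y"
    using solution_iff[OF recursion eqs(1)] eqs(2,3) by blast
  moreover have "combined_eq D V z y" if z: "z \<in> eta_combined_space D V" "formal_combined_solution D V p Pk z" for z
    using solution_iff[OF recursion z(1)] z(2) eqs(2,3)
    by (intro combined_eq_of_equations[OF recursion eqs(1) z(1)] unique) auto
  ultimately show "\<exists>y \<in> eta_combined_space (ball 0 r0) (quasi_sector \<alpha> \<beta> \<infinity> \<mu>).
      formal_combined_solution (ball 0 r0) (quasi_sector \<alpha> \<beta> \<infinity> \<mu>) p Pk y \<and>
      (\<forall>z \<in> eta_combined_space (ball 0 r0) (quasi_sector \<alpha> \<beta> \<infinity> \<mu>).
         formal_combined_solution (ball 0 r0) (quasi_sector \<alpha> \<beta> \<infinity> \<mu>) p Pk z \<longrightarrow>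
         combined_eq (ball 0 r0) (quasi_sector \<alpha> \<beta> \<infinity> \<mu>) z y)"
    using eqs(1) unfolding D_def V_def by blast
qed

end
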